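(* Let $C_1,\ldots,C_n\subset\mathrm{Gr}(1,\mathbb{P}^3)$ be congruences, where $C_i$ has bidegree $(1,\beta_i)$ for some $\beta_i\in\mathbb{N}$. Suppose that the $n$ focal loci $\mathcal{F}(C_1),\ldots,\mathcal{F}(C_n)$ are pairwise disjoint. Then $$M(C_1,\ldots,C_n)\;=\;V_n\,\cap\,(C_1\times\cdots\times C_n),$$ i.e., the concurrent lines variety $V_n$ gives an implicit representation of the multi-image variety $M(C_1,\ldots,C_n)$.
   Context: Work over $\mathbb{C}$. $\mathrm{Gr}(1,\mathbb{P}^3)\subset\mathbb{P}^5$ is the Grassmannian of lines in $\mathbb{P}^3$ in its Plücker embedding. A congruence is a surface $C\subset \mathrm{Gr}(1,\mathbb{P}^3)$, i.e. a two-dimensional family of lines in $\mathbb{P}^3$. Its bidegree is $(\alpha,\beta)$, where the order $\alpha$ is the number of lines of $C$ through a general point of $\mathbb{P}^3$ and the class $\beta$ is the number of lines of $C$ that lie in a general plane of $\mathbb{P}^3$. A point $x\in\mathbb{P}^3$ is a focal point of $C$ if $x$ does not belong to $\alpha$ distinct lines of $C$ (this may happen if $x$ belongs to fewer than $\alpha$ distinct lines, or to infinitely many lines of $C$); the focal locus $\mathcal{F}(C)\subset\mathbb{P}^3$ is the variety of focal points. If $C$ has order $1$, the rational camera of $C$ is the rational map $\mathbb{P}^3\dashrightarrow C$, $x\mapsto C(x)$, that sends a generic point $x$ to the unique line of $C$ through $x$; it is defined everywhere except at the focal locus. The multi-image variety $M(C_1,\ldots,C_n)$ is the closure in $\mathrm{Gr}(1,\mathbb{P}^3)^n\subset(\mathbb{P}^5)^n$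 of the image of the rational map $\mathbb{P}^3\dashrightarrow C_1\times\cdots\times C_n$, $x\mapsto(C_1(x),\ldots,C_n(x))$. The concurrent lines variety $V_n\subset\mathrm{Gr}(1,\mathbb{P}^3)^n\subset(\mathbb{P}^5)^n$ consists of the ordered $n$-tuples of lines in $\mathbb{P}^3$ that meet in a point. *)

theory Defs
  imports "HOL-Analysis.Analysis"
begin

section \<open>Products of complex projective spaces and their Zariski topology\<close>

text \<open>A point of the projective space of \<open>complex^'k\<close> is a one-dimensional complex
  linear subspace (hence \<open>vec.subspace\<close>, not the real \<open>subspace\<close>).  So
  \<open>projective_space :: (complex^4) set set\<close> is the projective 3-space.\<close>

definition projective_space :: "(complex^'k) set set" where
  "projective_space = {x. vec.subspace x \<and> vec.dim x = 1}"

definition multi_projective_space :: "('n \<Rightarrow> (complex^'k) set) set" where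
  "multi_projective_space = (\<Pi> i\<in>UNIV. projective_space)"

text \<open>Polynomials in the coordinates \<open>v i $ j\<close>.  The field being infinite, they
  may be identified with polynomial functions, and being homogeneous in each block of
  variables \<open>v i\<close> may be read off from the functions.\<close>

inductive polynomial_fun :: "(('n \<Rightarrow> complex^'k) \<Rightarrow> complex) \<Rightarrow> bool" where
  const: "polynomial_fun (\<lambda>v. c)"
| coord: "polynomial_fun (\<lambda>v. v i $ j)"
| add: "polynomial_fun p \<Longrightarrow> polynomial_fun q \<Longrightarrow> polynomial_fun (\<lambda>v. p v + q v)"
| mult: "polynomial_fun p \<Longrightarrow> polynomial_fun q \<Longrightarrow> polynomial_fun (\<lambda>v. p v * q v)"

definition multihomogeneous :: "(('n::finite \<Rightarrow> complex^'k) \<Rightarrow> complex) \<Rightarrow> bool" where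
  "multihomogeneous p \<longleftrightarrow>
     (\<exists>d :: 'n \<Rightarrow> nat. \<forall>c v. p (\<lambda>i. c i *s v i) = (\<Prod>i\<in>UNIV. c i ^ d i) * p v)"

definition vanishes_at ::
    "(('n \<Rightarrow> complex^'k) \<Rightarrow> complex) \<Rightarrow> ('n \<Rightarrow> (complex^'k) set) \<Rightarrow> bool" where
  "vanishes_at p X \<longleftrightarrow> (\<forall>v. (\<forall>i. v i \<in> X i \<and> v i \<noteq> 0) \<longrightarrow> p v = 0)"

definition zero_locus ::
    "(('n \<Rightarrow> complex^'k) \<Rightarrow> complex) set \<Rightarrow> ('n \<Rightarrow> (complex^'k) set) set" where
  "zero_locus P = {X \<in> multi_projective_space. \<forall>p\<in>P. vanishes_at p X}"

definition zariski_open :: "('n::finite \<Rightarrow> (complex^'k) set) set \<Rightarrow> bool" where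
  "zariski_open U \<longleftrightarrow>
     (\<exists>P. (\<forall>p\<in>P. polynomial_fun p \<and> multihomogeneous p) \<and>
          U = multi_projective_space - zero_locus P)"

definition zariski_topology :: "('n::finite \<Rightarrow> (complex^'k) set) topology" where
  "zariski_topology = topology zariski_open"

lemma multihomogeneous_mult:
  fixes p q :: "('n::finite \<Rightarrow> complex^'k) \<Rightarrow> complex"
  assumes "multihomogeneous p" "multihomogeneous q"
  shows "multihomogeneous (\<lambda>v. p v * q v)"
proof -
  obtain d where d: "\<And>c v. p (\<lambda>i. c i *s v i) = (\<Prod>i\<in>UNIV. c i ^ d i) * p v"
    using assms(1) unfolding multihomogeneous_def by blast
  obtain e where e: "\<And>c v. q (\<lambda>i. c i *s v i) = (\<Prod>i\<in>UNIV. c i ^ e i) * q v"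
    using assms(2) unfolding multihomogeneous_def by blast
  have "\<forall>c v. p (\<lambda>i. c i *s v i) * q (\<lambda>i. c i *s v i) =
      (\<Prod>i\<in>UNIV. c i ^ (d i + e i)) * (p v * q v)"
    unfolding d e by (simp add: power_add prod.distrib)
  then show ?thesis
    unfolding multihomogeneous_def by (intro exI[of _ "\<lambda>i. d i + e i"])
qed

lemma projective_space_proportional:
  fixes x :: "(complex^'k) set"
  assumes "x \<in> projective_space" "v \<in> x" "v \<noteq> 0" "w \<in> x"
  shows "\<exists>c. w = c *s v"
proof -
  have "vec.dim x = 1" "vec.subspace x"
    using assms(1) by (auto simp: projective_space_def)
  have "x \<subseteq> vec.span {v}"
  proof (rule vec.card_ge_dim_independent)
    show "{v} \<subseteq> x" using assms by simp
    show "vec.independent {v}" using assms(3) by simp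
    show "vec.dim x \<le> card {v}" using \<open>vec.dim x = 1\<close> by simp
  qed
  then show ?thesis
    using assms(4) by (auto simp: vec.span_singleton)
qed

lemma zero_locus_mult:
  fixes P Q :: "(('n::finite \<Rightarrow> complex^'k) \<Rightarrow> complex) set"
  assumes Q: "\<forall>q\<in>Q. multihomogeneous q"
  shows "zero_locus ((\<lambda>(p, q) v. p v * q v) ` (P \<times> Q)) = zero_locus P \<union> zero_locus Q"
    (is "zero_locus ?R = _")
proof (intro equalityI subsetI)
  fix X assume "X \<in> zero_locus P \<union> zero_locus Q"
  then show "X \<in> zero_locus ?R"
    unfolding zero_locus_def vanishes_at_def by fastforce
next
  fix X assume X: "X \<in> zero_locus ?R"
  then have XM: "X \<in> multi_projective_space" by (simp add: zero_locus_def)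
  show "X \<in> zero_locus P \<union> zero_locus Q"
  proof (rule ccontr)
    assume "X \<notin> zero_locus P \<union> zero_locus Q"
    then obtain p q v w where
      p: "p \<in> P" "\<And>i. v i \<in> X i" "\<And>i. v i \<noteq> 0" "p v \<noteq> 0" and
      q: "q \<in> Q" "\<And>i. w i \<in> X i" "\<And>i. w i \<noteq> 0" "q w \<noteq> 0"
      using XM unfolding zero_locus_def vanishes_at_def by blast
    have "\<exists>c. w i = c *s v i" for i
      using XM by (intro projective_space_proportional[of "X i", OF _ p(2) p(3) q(2)])
        (auto simp: multi_projective_space_def)
    then obtain c where "\<And>i. w i = c i *s v i" by metis
    then have w: "w = (\<lambda>i. c i *s v i)" by auto
    have "q v \<noteq> 0"
      using Q q(1,4) unfolding multihomogeneous_def w by fastforce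
    moreover have "vanishes_at (\<lambda>v. p v * q v) X"
      using X p(1) q(1) unfolding zero_locus_def by force
    ultimately show False
      using p unfolding vanishes_at_def by auto
  qed
qed

lemma istopology_zariski_open: "istopology zariski_open"
  unfolding istopology_def
proof (intro conjI allI impI)
  fix S T :: "('n::finite \<Rightarrow> (complex^'k) set) set"
  assume "zariski_open S" "zariski_open T"
  then obtain P Q where
    P: "\<forall>p\<in>P. polynomial_fun p \<and> multihomogeneous p" "S = multi_projective_space - zero_locus P" and
    Q: "\<forall>p\<in>Q. polynomial_fun p \<and> multihomogeneous p" "T = multi_projective_space - zero_locus Q"
    unfolding zariski_open_def by blast
  let ?R = "(\<lambda>(p, q) v. p v * q v) ` (P \<times> Q)"
  have "zero_locus ?R = zero_locus P \<union> zero_locus Q"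
    using Q(1) by (intro zero_locus_mult) blast
  moreover have "\<forall>p\<in>?R. polynomial_fun p \<and> multihomogeneous p"
    using P(1) Q(1) by (auto intro: polynomial_fun.mult multihomogeneous_mult)
  ultimately show "zariski_open (S \<inter> T)"
    unfolding zariski_open_def P(2) Q(2) by (intro exI[of _ ?R]) auto
next
  fix K :: "('n::finite \<Rightarrow> (complex^'k) set) set set"
  assume "\<forall>S\<in>K. zariski_open S"
  then have "\<forall>S\<in>K. \<exists>P. (\<forall>p\<in>P. polynomial_fun p \<and> multihomogeneous p) \<and>
      S = multi_projective_space - zero_locus P"
    unfolding zariski_open_def by blast
  then obtain F where F: "\<forall>S\<in>K. (\<forall>p\<in>F S. polynomial_fun p \<and> multihomogeneous p) \<and>
      S = multi_projective_space - zero_locus (F S)"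
    by (rule bchoice[THEN exE])
  then have "\<Union>K = (\<Union>S\<in>K. multi_projective_space - zero_locus (F S))"
    by auto
  also have "\<dots> = multi_projective_space - zero_locus (\<Union>(F ` K))"
    unfolding zero_locus_def by blast
  finally show "zariski_open (\<Union>K)"
    unfolding zariski_open_def using F by (intro exI[of _ "\<Union>(F ` K)"]) auto
qed

lemma openin_zariski_topology: "openin zariski_topology U \<longleftrightarrow> zariski_open U"
  by (simp add: zariski_topology_def topology_inverse' istopology_zariski_open)

text \<open>A single projective space is the product with the one-element index type \<open>unit\<close>.\<close>

definition projective_topology :: "(complex^'k) set topology" where
  "projective_topology =
     pullback_topology projective_space (\<lambda>x (_::unit). x) zariski_topology"

definition irreducible_in :: "'a topology \<Rightarrow> 'a set \<Rightarrow> bool" where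
  "irreducible_in T S \<longleftrightarrow> S \<noteq> {} \<and> S \<subseteq> topspace T \<and>
     (\<forall>A B. closedin T A \<longrightarrow> closedin T B \<longrightarrow> S \<subseteq> A \<union> B \<longrightarrow> S \<subseteq> A \<or> S \<subseteq> B)"

definition krull_dim :: "'a topology \<Rightarrow> 'a set \<Rightarrow> enat" where
  "krull_dim T S = Sup {enat m | m. \<exists>Z :: nat \<Rightarrow> 'a set.
     (\<forall>i\<le>m. closedin T (Z i) \<and> irreducible_in T (Z i) \<and> Z i \<subseteq> S) \<and>
     (\<forall>i<m. Z i \<subset> Z (Suc i))}"

section \<open>Lines in projective 3-space\<close>

text \<open>A line in projective 3-space is a two-dimensional subspace of \<open>complex^4\<close>; the
  point \<open>x\<close> lies on the line \<open>L\<close> iff \<open>x \<subseteq> L\<close>.\<close>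

definition Gr :: "(complex^4) set set" where
  "Gr = {L. vec.subspace L \<and> vec.dim L = 2}"

definition wedge :: "complex^4 \<Rightarrow> complex^4 \<Rightarrow> complex^6" where
  "wedge u v = vector
     [u$1 * v$2 - u$2 * v$1, u$1 * v$3 - u$3 * v$1, u$1 * v$4 - u$4 * v$1,
      u$2 * v$3 - u$3 * v$2, u$2 * v$4 - u$4 * v$2, u$3 * v$4 - u$4 * v$3]"

definition pluecker :: "(complex^4) set \<Rightarrow> (complex^6) set" where
  "pluecker L = vec.span {wedge u v | u v. u \<in> L \<and> v \<in> L}"

lemma wedge_nth [simp]:
  "wedge u v $ 1 = u$1 * v$2 - u$2 * v$1"
  "wedge u v $ 2 = u$1 * v$3 - u$3 * v$1"
  "wedge u v $ 3 = u$1 * v$4 - u$4 * v$1"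
  "wedge u v $ 4 = u$2 * v$3 - u$3 * v$2"
  "wedge u v $ 5 = u$2 * v$4 - u$4 * v$2"
  "wedge u v $ 6 = u$3 * v$4 - u$4 * v$3"
  by (simp_all add: wedge_def vector_def)

lemma exhaust_6:
  fixes i :: 6
  shows "i = 1 \<or> i = 2 \<or> i = 3 \<or> i = 4 \<or> i = 5 \<or> i = 6"
proof (induct i)
  case (of_int z)
  then have "z = 0 \<or> z = 1 \<or> z = 2 \<or> z = 3 \<or> z = 4 \<or> z = 5" by auto
  then show ?case by auto
qed

lemma forall_6: "(\<forall>i::6. P i) \<longleftrightarrow> P 1 \<and> P 2 \<and> P 3 \<and> P 4 \<and> P 5 \<and> P 6"
  by (metis exhaust_6)

lemma wedge_linear_combination:
  "wedge (a *s u + b *s v) (c *s u + d *s v) = (a * d - b * c) *s wedge u v"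
  by (simp add: vec_eq_iff forall_6 algebra_simps)

lemma wedge_eq_0_imp_proportional:
  assumes "wedge u v = 0" "u \<noteq> 0"
  shows "\<exists>c. v = c *s u"
proof -
  have 0: "u$i * v$j = u$j * v$i" for i j
  proof -
    have "u$1 * v$2 = u$2 * v$1 \<and> u$1 * v$3 = u$3 * v$1 \<and> u$1 * v$4 = u$4 * v$1 \<and>
        u$2 * v$3 = u$3 * v$2 \<and> u$2 * v$4 = u$4 * v$2 \<and> u$3 * v$4 = u$4 * v$3"
      using assms(1) by (simp add: vec_eq_iff forall_6)
    then have "\<forall>i j. u$i * v$j = u$j * v$i"
      by (simp add: forall_4)
    then show ?thesis by blast
  qed
  obtain i where "u$i \<noteq> 0"
    using assms(2) by (auto simp: vec_eq_iff)
  then have "v = (v$i / u$i) *s u"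
    using 0[of i] by (simp add: vec_eq_iff field_simps)
  then show ?thesis ..
qed

lemma pluecker_in_projective_space:
  assumes "L \<in> Gr"
  shows "pluecker L \<in> projective_space"
proof -
  have L: "vec.subspace L" "vec.dim L = 2"
    using assms by (auto simp: Gr_def)
  obtain B where B: "B \<subseteq> L" "vec.independent B" "L \<subseteq> vec.span B" "card B = 2"
    using vec.basis_exists[of L] L(2) by metis
  obtain u v where uv: "B = {u, v}" "u \<noteq> v"
    using B(4) by (auto simp: card_2_iff)
  have L_eq: "L = {w. \<exists>a b. w = a *s u + b *s v}"
  proof -
    have "vec.span B = L"
      using B(1,3) L(1) vec.span_minimal by blast
    then show ?thesis
      unfolding uv by (auto simp: vec.span_insert vec.span_singleton algebra_simps)
  qed
  have u: "u \<noteq> 0"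
    using B(2) uv vec.dependent_zero[of B] by auto
  have "vec.independent (insert v {u})"
    using B(2) uv by (simp add: insert_commute)
  then have v: "\<nexists>c. v = c *s u"
    using uv(2) by (auto simp: vec.independent_insert vec.span_singleton)
  have nz: "wedge u v \<noteq> 0"
    using wedge_eq_0_imp_proportional u v by blast
  have "{wedge a b | a b. a \<in> L \<and> b \<in> L} = vec.span {wedge u v}"
  proof (intro equalityI subsetI)
    fix w assume "w \<in> {wedge a b | a b. a \<in> L \<and> b \<in> L}"
    then show "w \<in> vec.span {wedge u v}"
      unfolding L_eq
      by (auto simp: wedge_linear_combination vec.span_singleton simp del: vector_sub_rdistrib)
  next
    fix w assume "w \<in> vec.span {wedge u v}"
    then obtain c where "w = c *s wedge u v"
      by (auto simp: vec.span_singleton)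
    then have "w = wedge (c *s u + 0 *s v) (0 *s u + 1 *s v)"
      by (simp only: wedge_linear_combination) simp
    then show "w \<in> {wedge a b | a b. a \<in> L \<and> b \<in> L}"
      unfolding L_eq by blast
  qed
  then have "pluecker L = vec.span {wedge u v}"
    by (simp add: pluecker_def vec.span_span)
  moreover have "vec.dim {wedge u v} = 1"
    using nz vec.dim_eq_card_independent[of "{wedge u v}"] by simp
  ultimately show ?thesis
    by (simp add: projective_space_def vec.dim_span)
qed

text \<open>The Zariski topology of the Grassmannian and of its powers, induced from the
  Pluecker embedding.\<close>

definition Gr_topology :: "(complex^4) set topology" where
  "Gr_topology = pullback_topology Gr (\<lambda>L (_::unit). pluecker L) zariski_topology"

definition Gr_power_topology :: "('n::finite \<Rightarrow> (complex^4) set) topology" where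
  "Gr_power_topology =
     pullback_topology (\<Pi> i\<in>UNIV. Gr) (\<lambda>L i. pluecker (L i)) zariski_topology"

section \<open>Congruences\<close>

text \<open>A surface is taken to be irreducible, and closed.\<close>

definition congruence :: "(complex^4) set set \<Rightarrow> bool" where
  "congruence C \<longleftrightarrow>
     closedin Gr_topology C \<and> irreducible_in Gr_topology C \<and> krull_dim Gr_topology C = 2"

definition for_general_point :: "((complex^4) set \<Rightarrow> bool) \<Rightarrow> bool" where
  "for_general_point Q \<longleftrightarrow> (\<exists>U. openin projective_topology U \<and> U \<noteq> {} \<and> (\<forall>x\<in>U. Q x))"

definition lines_through :: "(complex^4) set set \<Rightarrow> (complex^4) set \<Rightarrow> (complex^4) set set" where
  "lines_through C x = {L \<in> C. x \<subseteq> L}"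

definition lines_within :: "(complex^4) set set \<Rightarrow> (complex^4) set \<Rightarrow> (complex^4) set set" where
  "lines_within C H = {L \<in> C. L \<subseteq> H}"

text \<open>The plane with equation \<open>\<Sum>j. a $ j * v $ j = 0\<close>, for a point of the dual projective
  space represented by \<open>a\<close>.\<close>

definition dual_plane :: "(complex^4) set \<Rightarrow> (complex^4) set" where
  "dual_plane h = {v. \<forall>a\<in>h. (\<Sum>j\<in>UNIV. a $ j * v $ j) = 0}"

definition has_order :: "(complex^4) set set \<Rightarrow> nat \<Rightarrow> bool" where
  "has_order C \<alpha> \<longleftrightarrow>
     for_general_point (\<lambda>x. finite (lines_through C x) \<and> card (lines_through C x) = \<alpha>)"

definition has_class :: "(complex^4) set set \<Rightarrow> nat \<Rightarrow> bool" where
  "has_class C \<beta> \<longleftrightarrow>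
     for_general_point (\<lambda>h. finite (lines_within C (dual_plane h)) \<and>
                            card (lines_within C (dual_plane h)) = \<beta>)"

definition has_bidegree :: "(complex^4) set set \<Rightarrow> nat \<times> nat \<Rightarrow> bool" where
  "has_bidegree C d \<longleftrightarrow> has_order C (fst d) \<and> has_class C (snd d)"

text \<open>The number \<open>\<alpha>\<close> below is unique, since projective space is irreducible.\<close>

definition focal_locus :: "(complex^4) set set \<Rightarrow> (complex^4) set set" where
  "focal_locus C = {x \<in> projective_space. \<exists>\<alpha>. has_order C \<alpha> \<and>
     \<not> (finite (lines_through C x) \<and> card (lines_through C x) = \<alpha>)}"

section \<open>Multi-image variety and concurrent lines variety\<close>

text \<open>Meaningful for \<open>C\<close> of order 1 and \<open>x\<close> outside the focal locus of \<open>C\<close>.\<close>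

definition rational_camera :: "(complex^4) set set \<Rightarrow> (complex^4) set \<Rightarrow> (complex^4) set" where
  "rational_camera C x = (THE L. L \<in> C \<and> x \<subseteq> L)"

definition multi_image_variety ::
    "('n::finite \<Rightarrow> (complex^4) set set) \<Rightarrow> ('n \<Rightarrow> (complex^4) set) set" where
  "multi_image_variety C = Gr_power_topology closure_of
     ((\<lambda>x i. rational_camera (C i) x) ` (projective_space - (\<Union>i. focal_locus (C i))))"

definition concurrent_lines_variety :: "('n::finite \<Rightarrow> (complex^4) set) set" where
  "concurrent_lines_variety =
     {L \<in> (\<Pi> i\<in>UNIV. Gr). \<exists>x\<in>projective_space. \<forall>i. x \<subseteq> L i}"

end

theory Submission
  imports Defs "HOL-Computational_Algebra.Fundamental_Theorem_Algebra"
begin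

text \<open>The right-hand side is closed and contains the image of the cameras, so it contains the
  multi-image variety.  Conversely, let lines \<open>L i \<in> C i\<close> meet in a point \<open>x\<close>.  Since the focal
  loci are disjoint, there is an index \<open>j\<close> such that \<open>L i\<close> is the only line of \<open>C i\<close> through \<open>x\<close>
  for all \<open>i \<noteq> j\<close>.  Consider the pairs \<open>(y, M)\<close> with \<open>y\<close> on \<open>M \<in> C j\<close> for which there are lines
  of the other congruences through \<open>y\<close> that together with \<open>M\<close> form a point of the multi-image
  variety.  By elimination theory these pairs form a closed subset of the incidence variety, and
  it contains the pairs over a general point \<open>y\<close>.  The incidence variety is irreducible, being a
  bundle of projective lines over \<open>C j\<close>; hence the subset is everything and contains
  \<open>(x, L j)\<close>.  By uniqueness the other lines are the \<open>L i\<close>.\<close>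

section \<open>Polynomial functions\<close>

text \<open>Over a focal point of \<open>C j\<close> the line \<open>L j\<close> need not be the
  only line of \<open>C j\<close>, so no camera selects it, and approaching it through general
  points would require control over what the other cameras do meanwhile. Keeping the point and the
  \<open>j\<close>-th line as parameters avoids this: the other lines range over projective spaces,
  where the needed limits exist by properness, and properness is what the elimination part supplies.
  Disjointness of the focal loci confines non-uniqueness to the one index whose line is a parameter.

  Two kinds of polynomials coexist. Elimination works on affine cones with arbitrary polynomials
  (\<open>algebraic_set\<close>), whereas the topology of lines has only multihomogeneous equations.
  \<open>ex_homogeneous_component\<close> bridges the two when irreducibility of a congruence is
  applied. For the closedness of the concurrent lines variety the linear elimination is run with
  multidegrees attached instead.\<close>

lemma polynomial_fun_uminus: "polynomial_fun p \<Longrightarrow> polynomial_fun (\<lambda>v. - p v)"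
  using polynomial_fun.mult[OF polynomial_fun.const[of "-1"]] by simp

lemma polynomial_fun_diff:
  "polynomial_fun p \<Longrightarrow> polynomial_fun q \<Longrightarrow> polynomial_fun (\<lambda>v. p v - q v)"
  using polynomial_fun.add[OF _ polynomial_fun_uminus] by fastforce

lemma polynomial_fun_sum:
  "(\<And>x. x \<in> A \<Longrightarrow> polynomial_fun (f x)) \<Longrightarrow> polynomial_fun (\<lambda>v. \<Sum>x\<in>A. f x v)"
  by (induction A rule: infinite_finite_induct) (auto intro: polynomial_fun.intros)

lemma polynomial_fun_prod:
  "(\<And>x. x \<in> A \<Longrightarrow> polynomial_fun (f x)) \<Longrightarrow> polynomial_fun (\<lambda>v. \<Prod>x\<in>A. f x v)"
  by (induction A rule: infinite_finite_induct) (auto intro: polynomial_fun.intros)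

lemmas polynomial_fun_intros =
  polynomial_fun.intros polynomial_fun_uminus polynomial_fun_diff polynomial_fun_sum
  polynomial_fun_prod

lemma polynomial_fun_compose:
  assumes "polynomial_fun p" "\<And>i j. polynomial_fun (\<lambda>v. \<phi> v i $ j)"
  shows "polynomial_fun (\<lambda>v. p (\<phi> v))"
  using assms(1) by induction (auto intro: assms(2) polynomial_fun.intros)

text \<open>Restriction to the line through \<open>v\<close> and \<open>w\<close> reduces
  nonvanishing questions to univariate polynomials, which have finitely many roots.\<close>

lemma polynomial_fun_on_line:
  assumes "polynomial_fun p"
  shows "\<exists>q. \<forall>t. p (\<lambda>i. v i + t *s (w i - v i)) = poly q t"
  using assms
proof induction
  case (const c)
  show ?case by (rule exI[of _ "[:c:]"]) simp
next
  case (coord i j)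
  show ?case by (rule exI[of _ "[:v i $ j, w i $ j - v i $ j:]"]) (simp add: algebra_simps)
next
  case (add p q)
  then show ?case by (metis poly_add)
next
  case (mult p q)
  then show ?case by (metis poly_mult)
qed

text \<open>The finite set \<open>A\<close> serves to keep a scaling factor away from 0.\<close>

lemma poly_ex_nonzero_both:
  fixes p q :: "complex poly"
  assumes "p \<noteq> 0" "q \<noteq> 0" "finite A"
  shows "\<exists>t. t \<notin> A \<and> poly p t \<noteq> 0 \<and> poly q t \<noteq> 0"
proof -
  have "finite (A \<union> {t. poly (p * q) t = 0})"
    using assms by (intro finite_UnI poly_roots_finite) auto
  then obtain t where "t \<notin> A \<union> {t. poly (p * q) t = 0}"
    using ex_new_if_finite infinite_UNIV_char_0 by blast
  then show ?thesis by auto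
qed

text \<open>Irreducibility of affine space: on the line joining \<open>v\<close> and
  \<open>w\<close> neither restriction is the zero polynomial.\<close>

lemma polynomial_fun_ex_nonzero_both:
  assumes "polynomial_fun p" "polynomial_fun q" "p v \<noteq> 0" "q w \<noteq> 0"
  shows "\<exists>u. p u \<noteq> 0 \<and> q u \<noteq> 0"
proof -
  obtain P where P: "p (\<lambda>i. v i + t *s (w i - v i)) = poly P t" for t
    using polynomial_fun_on_line[OF assms(1)] by blast
  obtain Q where Q: "q (\<lambda>i. v i + t *s (w i - v i)) = poly Q t" for t
    using polynomial_fun_on_line[OF assms(2)] by blast
  have "P \<noteq> 0" using P[of 0] assms(3) by auto
  moreover have "Q \<noteq> 0" using Q[of 1] assms(4) by auto
  ultimately show ?thesis
    using poly_ex_nonzero_both[of P Q "{}"] P Q by (metis finite.emptyI)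
qed

text \<open>Division-free Gaussian elimination on a possibly infinite family of rows.  The predicate
  \<open>G\<close> on rows is abstract so that the pivots can also be kept multihomogeneous.\<close>

lemma linear_system_elimination:
  fixes G :: "(nat \<Rightarrow> 'y \<Rightarrow> complex) \<Rightarrow> bool" and M :: "('y \<Rightarrow> complex) \<Rightarrow> bool"
  assumes G: "\<And>v w l. G v \<Longrightarrow> G w \<Longrightarrow> G (\<lambda>k y. v l y * w k y - w l y * v k y)"
    and GM: "\<And>v k. G v \<Longrightarrow> M (v k)"
    and M1: "M (\<lambda>y. 1)" and MM: "\<And>p q. M p \<Longrightarrow> M q \<Longrightarrow> M (\<lambda>y. p y * q y)"
  assumes "\<forall>v\<in>V. G v"
    and "\<And>z. (\<forall>v\<in>V. (\<Sum>k<N. v k y0 * z k) = 0) \<Longrightarrow> (\<forall>k<N. z k = (0::complex))"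
  shows "\<exists>m. M m \<and> m y0 \<noteq> 0 \<and>
    (\<forall>y z. m y \<noteq> 0 \<longrightarrow> (\<forall>v\<in>V. (\<Sum>k<N. v k y * z k) = 0) \<longrightarrow> (\<forall>k<N. z k = 0))"
  using assms(5-)
proof (induction N arbitrary: V)
  case 0
  then show ?case using M1 by auto
next
  case (Suc N)
  have "\<exists>v\<in>V. v N y0 \<noteq> 0"
  proof (rule ccontr)
    assume "\<not> ?thesis"
    \<comment> \<open>If the last column vanished at \<open>y0\<close>, the last unit vector would
      be a nontrivial solution there.\<close>
    then have "\<forall>v\<in>V. (\<Sum>k<Suc N. v k y0 * (if k = N then 1 else 0)) = 0"
      by simp
    from Suc.prems(2)[OF this] show False by auto
  qed
  then obtain v where v: "v \<in> V" "v N y0 \<noteq> 0" by blast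
  define V' where "V' = (\<lambda>w k y. v N y * w k y - w N y * v k y) ` V"
  have V': "(\<Sum>k<N. (v N y * w k y - w N y * v k y) * z k) =
      v N y * (\<Sum>k<N. w k y * z k) - w N y * (\<Sum>k<N. v k y * z k)" for w y z
    by (simp add: sum_distrib_left sum_subtractf algebra_simps)
  have "\<exists>m. M m \<and> m y0 \<noteq> 0 \<and>
    (\<forall>y z. m y \<noteq> 0 \<longrightarrow> (\<forall>v\<in>V'. (\<Sum>k<N. v k y * z k) = 0) \<longrightarrow> (\<forall>k<N. z k = 0))"
  proof (rule Suc.IH)
    show "\<forall>v\<in>V'. G v"
      using Suc.prems(1) v(1) G unfolding V'_def by auto
    fix z assume z: "\<forall>v\<in>V'. (\<Sum>k<N. v k y0 * z k) = 0"
    \<comment> \<open>Back substitution: the last entry is chosen so that the pivot row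
      \<open>v\<close> is satisfied at \<open>y0\<close>.\<close>
    define z' where "z' k = (if k = N then - (\<Sum>k<N. v k y0 * z k) / v N y0 else z k)" for k
    have "\<forall>w\<in>V. (\<Sum>k<Suc N. w k y0 * z' k) = 0"
    proof
      fix w assume "w \<in> V"
      then have "v N y0 * (\<Sum>k<N. w k y0 * z k) = w N y0 * (\<Sum>k<N. v k y0 * z k)"
        using z unfolding V'_def by (simp add: V')
      moreover have "(\<Sum>k<N. w k y0 * z' k) = (\<Sum>k<N. w k y0 * z k)"
        by (simp add: z'_def)
      ultimately show "(\<Sum>k<Suc N. w k y0 * z' k) = 0"
        using v(2) by (simp add: z'_def field_simps)
    qed
    from Suc.prems(2)[OF this] have "\<forall>k<N. z' k = 0"
      by simp
    then show "\<forall>k<N. z k = 0"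
      by (simp add: z'_def)
  qed
  then obtain m where m: "M m" "m y0 \<noteq> 0" 
    "\<And>y z. m y \<noteq> 0 \<Longrightarrow> (\<forall>v\<in>V'. (\<Sum>k<N. v k y * z k) = 0) \<Longrightarrow> (\<forall>k<N. z k = 0)"
    by blast
  \<comment> \<open>The polynomial built up is the product of all pivots; where none of them
    vanishes, the same elimination forces the zero solution.\<close>
  show ?case
  proof (intro exI[of _ "\<lambda>y. v N y * m y"] conjI allI impI)
    show "M (\<lambda>y. v N y * m y)" using MM GM Suc.prems(1) v(1) m(1) by blast
    show "v N y0 * m y0 \<noteq> 0" using v m by simp
    fix y z k
    assume y: "v N y * m y \<noteq> 0" and z: "\<forall>v\<in>V. (\<Sum>k<Suc N. v k y * z k) = 0" and k: "k < Suc N"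
    have *: "(\<Sum>k<N. w k y * z k) = - (w N y * z N)" if "w \<in> V" for w
      using z that by (simp add: eq_neg_iff_add_eq_0)
    have "\<forall>v\<in>V'. (\<Sum>k<N. v k y * z k) = 0"
      using v(1) unfolding V'_def by (auto simp: V' *)
    then have 0: "\<forall>k<N. z k = 0" using m(3) y by auto
    then have "v N y * z N = 0" using *[OF v(1)] by simp
    then show "z k = 0" using 0 y k by (auto simp: less_Suc_eq)
  qed
qed

text \<open>The one-variable Nullstellensatz: a nonzero element of least degree divides all others,
  and a root of it would be a common root.\<close>

lemma poly_ideal_without_common_root:
  fixes J :: "complex poly set"
  assumes "0 \<in> J"
    and add: "\<And>p q. p \<in> J \<Longrightarrow> q \<in> J \<Longrightarrow> p + q \<in> J"
    and mult: "\<And>p q. p \<in> J \<Longrightarrow> q * p \<in> J"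
    and root: "\<And>t. \<exists>p\<in>J. poly p t \<noteq> 0"
  shows "1 \<in> J"
proof -
  obtain p where "p \<in> J" "p \<noteq> 0" using root[of 0] by (metis poly_0)
  then obtain g where g: "g \<in> J" "g \<noteq> 0" 
    and min: "\<And>q. q \<in> J \<Longrightarrow> q \<noteq> 0 \<Longrightarrow> degree g \<le> degree q"
    using ex_has_least_nat[of "\<lambda>q. q \<in> J \<and> q \<noteq> 0" p degree] by blast
  have dvd: "g dvd q" if "q \<in> J" for q
  proof (rule ccontr)
    assume "\<not> g dvd q"
    then have "q mod g \<noteq> 0" by (simp add: dvd_eq_mod_eq_0)
    moreover have "q mod g = q + (- (q div g)) * g"
      by (simp add: minus_div_mult_eq_mod [symmetric])
    then have "q mod g \<in> J" using add[OF that mult[OF g(1), of "- (q div g)"]] by metis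
    ultimately show False
      using min[of "q mod g"] degree_mod_less[OF g(2), of q] by auto
  qed
  have "degree g = 0"
  proof (rule ccontr)
    assume "degree g \<noteq> 0"
    then obtain t where "poly g t = 0"
      using fundamental_theorem_of_algebra[of g] constant_degree[of g] by auto
    then have "poly q t = 0" if "q \<in> J" for q
      using dvd[OF that] by (auto elim!: dvdE)
    then show False using root by blast
  qed
  then obtain c where "g = [:c:]" by (meson degree_eq_zeroE)
  then have "[:1 / c:] * g = 1" using g(2) by auto
  then show ?thesis using mult[OF g(1)] by metis
qed

section \<open>Elimination theory\<close>

text \<open>A common zero \<open>(s, t)\<close> yields the functional \<open>z k = s ^ (N - k) * t ^ k\<close> on forms of
  degree \<open>N\<close>, which kills the part of degree \<open>N\<close> of the ideal generated by the forms;
  without a common zero this part is everything for large \<open>N\<close>.\<close>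

definition annihilates :: "(nat \<times> (nat \<Rightarrow> complex)) set \<Rightarrow> nat \<Rightarrow> (nat \<Rightarrow> complex) \<Rightarrow> bool" where
  "annihilates F N z \<longleftrightarrow>
     (\<forall>(d, c)\<in>F. \<forall>a. a + d \<le> N \<longrightarrow> (\<Sum>k\<le>d. c k * z (k + a)) = 0)"

text \<open>This treats the chart \<open>s = 1\<close>, where the forms become univariate
  polynomials without a common root. The polynomials whose homogenisations are killed by all
  functionals form an ideal, so 1 is among them. The bound \<open>D\<close> does not depend on
  \<open>N\<close>, which leaves \<open>N\<close> free to be chosen later.\<close>

lemma annihilates_shift_poly:
  fixes F :: "(nat \<times> (nat \<Rightarrow> complex)) set"
  assumes "\<And>t. \<exists>(d, c)\<in>F. (\<Sum>k\<le>d. c k * t ^ k) \<noteq> 0"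
  shows "\<exists>D. \<forall>N z a. annihilates F N z \<longrightarrow> a + D \<le> N \<longrightarrow> z a = 0"
proof -
  define I where "I p D \<longleftrightarrow> degree p \<le> D \<and>
    (\<forall>N z a n. annihilates F N z \<longrightarrow> a + D \<le> N \<longrightarrow> degree p \<le> n \<longrightarrow> (\<Sum>k\<le>n. coeff p k * z (k + a)) = 0)"
    for p :: "complex poly" and D
  have I_sum: "(\<Sum>k\<le>n. coeff p k * z (k + a)) = 0"
    if "I p D" "annihilates F N z" "a + D \<le> N" "degree p \<le> n" for p D N z a n
    using that unfolding I_def by blast
  have I_mono: "I p D'" if "I p D" "D \<le> D'" for p D D'
    using that unfolding I_def by (meson add_left_mono order_trans)
  have I_add: "I (p + q) D" if "I p D" "I q D" for p q D
    unfolding I_def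
  proof (intro conjI allI impI)
    show "degree (p + q) \<le> D" using that by (simp add: I_def degree_add_le)
    fix N z a n assume H: "annihilates F N z" "a + D \<le> N" "degree (p + q) \<le> n"
    define n' where "n' = max n (max (degree p) (degree q))"
    have "(\<Sum>k\<le>n. coeff (p + q) k * z (k + a)) = (\<Sum>k\<le>n'. coeff (p + q) k * z (k + a))"
      using H(3) by (intro sum.mono_neutral_left) (auto simp: n'_def coeff_eq_0 simp del: coeff_add)
    also have "\<dots> = (\<Sum>k\<le>n'. coeff p k * z (k + a)) + (\<Sum>k\<le>n'. coeff q k * z (k + a))"
      by (simp add: sum.distrib algebra_simps)
    also have "\<dots> = 0"
      using I_sum[OF that(1) H(1,2), of n'] I_sum[OF that(2) H(1,2), of n'] by (simp add: n'_def)
    finally show "(\<Sum>k\<le>n. coeff (p + q) k * z (k + a)) = 0" .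
  qed
  have I_smult: "I (smult c p) D" if "I p D" for p c D
    unfolding I_def
  proof (intro conjI allI impI)
    show "degree (smult c p) \<le> D" using that by (simp add: I_def)
    fix N z a n assume H: "annihilates F N z" "a + D \<le> N" "degree (smult c p) \<le> n"
    show "(\<Sum>k\<le>n. coeff (smult c p) k * z (k + a)) = 0"
    proof (cases "c = 0")
      case False
      then have "(\<Sum>k\<le>n. coeff p k * z (k + a)) = 0"
        using H that unfolding I_def by simp
      then show ?thesis by (simp add: mult.assoc flip: sum_distrib_left)
    qed simp
  qed
  have I_pCons: "I (pCons 0 p) (Suc D)" if "I p D" for p D
    unfolding I_def
  proof (intro conjI allI impI)
    show "degree (pCons 0 p) \<le> Suc D"
      using that degree_pCons_le[of 0 p] by (simp add: I_def)
    fix N z a n assume H: "annihilates F N z" "a + Suc D \<le> N" "degree (pCons 0 p) \<le> n"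
    show "(\<Sum>k\<le>n. coeff (pCons 0 p) k * z (k + a)) = 0"
    proof (cases n)
      case (Suc n')
      have "degree p \<le> n'"
        using H(3) Suc by (cases "p = 0") (simp_all add: degree_pCons_eq)
      moreover have "Suc a + D \<le> N" using H by simp
      ultimately have "(\<Sum>k\<le>n'. coeff p k * z (k + Suc a)) = 0"
        using that H(1) by (intro I_sum)
      then show ?thesis unfolding Suc by (subst sum.atMost_Suc_shift) simp
    qed simp
  qed
  have "1 \<in> {p. \<exists>D. I p D}"
  proof (rule poly_ideal_without_common_root)
    show "0 \<in> {p. \<exists>D. I p D}" by (auto simp: I_def)
    show add: "p + q \<in> {p. \<exists>D. I p D}" if pq: "p \<in> {p. \<exists>D. I p D}" "q \<in> {p. \<exists>D. I p D}" for p q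
    proof -
      obtain D E where "I p D" "I q E" using pq by blast
      then have "I p (max D E)" "I q (max D E)" by (auto intro: I_mono)
      then show ?thesis using I_add by blast
    qed
    show "q * p \<in> {p. \<exists>D. I p D}" if p: "p \<in> {p. \<exists>D. I p D}" for p q
    proof (induction q)
      case 0
      show ?case by (auto simp: I_def)
    next
      case (pCons c q)
      have "smult c p \<in> {p. \<exists>D. I p D}" using p I_smult by blast
      moreover have "pCons 0 (q * p) \<in> {p. \<exists>D. I p D}" using pCons(2) I_pCons by blast
      ultimately show ?case
        unfolding mult_pCons_left by (rule add)
    qed
    fix t
    obtain d c where dc: "(d, c) \<in> F" "(\<Sum>k\<le>d. c k * t ^ k) \<noteq> 0" using assms by blast
    define p where "p = (\<Sum>k\<le>d. monom (c k) k)"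
    have coeff: "coeff p k = (if k \<le> d then c k else 0)" for k
      unfolding p_def by (simp add: coeff_sum)
    have "I p d"
      unfolding I_def
    proof (intro conjI allI impI)
      show "degree p \<le> d" by (rule degree_le) (simp add: coeff)
      fix N z a n assume H: "annihilates F N z" "a + d \<le> N" "degree p \<le> n"
      have "(\<Sum>k\<le>n. coeff p k * z (k + a)) = (\<Sum>k\<le>max n d. coeff p k * z (k + a))"
        using H(3) by (intro sum.mono_neutral_left) (auto simp: coeff_eq_0)
      also have "\<dots> = (\<Sum>k\<le>d. coeff p k * z (k + a))"
        by (intro sum.mono_neutral_right) (auto simp: coeff)
      also have "\<dots> = (\<Sum>k\<le>d. c k * z (k + a))"
        by (intro sum.cong) (auto simp: coeff)
      also have "\<dots> = 0"
        using H dc(1) unfolding annihilates_def by blast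
      finally show "(\<Sum>k\<le>n. coeff p k * z (k + a)) = 0" .
    qed
    moreover have "poly p t = (\<Sum>k\<le>d. c k * t ^ k)"
      unfolding p_def by (simp add: poly_sum poly_monom)
    ultimately show "\<exists>p\<in>{p. \<exists>D. I p D}. poly p t \<noteq> 0" using dc by auto
  qed
  then obtain D where D: "I 1 D" by blast
  have "z a = 0" if "annihilates F N z" "a + D \<le> N" for N z a
  proof -
    have "(\<Sum>k\<le>0. coeff 1 k * z (k + a)) = 0"
      using D that unfolding I_def by (metis degree_1 order_refl)
    then show ?thesis by simp
  qed
  then show ?thesis by blast
qed

text \<open>The chart \<open>s = 1\<close> misses only the point \<open>(0, 1)\<close>. Some form is
  nonzero there, which means that its top coefficient \<open>c d\<close> is nonzero, and this
  equation expresses each later \<open>z k\<close> by earlier entries.\<close>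

lemma annihilates_eq_0:
  fixes F :: "(nat \<times> (nat \<Rightarrow> complex)) set"
  assumes "\<And>s t. (\<forall>(d, c)\<in>F. (\<Sum>k\<le>d. c k * s ^ (d - k) * t ^ k) = 0) \<Longrightarrow> s = 0 \<and> t = 0"
  shows "\<exists>N. \<forall>z. annihilates F N z \<longrightarrow> (\<forall>k\<le>N. z k = 0)"
proof -
  have "\<exists>(d, c)\<in>F. (\<Sum>k\<le>d. c k * t ^ k) \<noteq> 0" for t
    using assms[of 1 t] by fastforce
  then obtain D where D: "\<And>N z a. annihilates F N z \<Longrightarrow> a + D \<le> N \<Longrightarrow> z a = 0"
    using annihilates_shift_poly by meson
  obtain d c where dc: "(d, c) \<in> F" "c d \<noteq> 0"
  proof -
    have "\<exists>(d, c)\<in>F. (\<Sum>k\<le>d. c k * 0 ^ (d - k) * 1 ^ k) \<noteq> 0"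
      using assms[of 0 1] by fastforce
    then obtain d c where dc: "(d, c) \<in> F" "(\<Sum>k\<le>d. c k * 0 ^ (d - k) * 1 ^ k) \<noteq> 0" by blast
    have "(\<Sum>k\<le>d. c k * 0 ^ (d - k) * 1 ^ k) = (\<Sum>k\<le>d. if k = d then c k else 0)"
      by (intro sum.cong) (auto simp: power_0_left)
    then show thesis using that dc by simp
  qed
  \<comment> \<open>With \<open>N = D + d\<close> the chart accounts for all indices below
    \<open>d\<close>, enough to start a recursion of depth \<open>d\<close>.\<close>
  have "z k = 0" if z: "annihilates F (D + d) z" and "k \<le> D + d" for z k
    using that(2)
  proof (induction k rule: less_induct)
    case (less k)
    show ?case
    proof (cases "k < d")
      case True
      then show ?thesis using D[OF z, of k] by simp
    next
      case False
      have "(\<Sum>i\<le>d. c i * z (i + (k - d))) = 0"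
        using z[unfolded annihilates_def, THEN bspec, OF dc(1), simplified, rule_format, of "k - d"]
          less.prems False by simp
      moreover have "(\<Sum>i\<le>d. c i * z (i + (k - d))) = (\<Sum>i\<le>d. if i = d then c d * z k else 0)"
        using less False by (intro sum.cong) auto
      ultimately show ?thesis using dc(2) by simp
    qed
  qed
  then show ?thesis by blast
qed

text \<open>A resultant argument. Having no common zero at \<open>y0\<close> becomes full column
  rank of a matrix of Macaulay type, whose entries are coefficients of the forms. The product of its
  pivots is a polynomial in \<open>y\<close>, so the rank persists wherever that product is
  nonzero.\<close>

lemma forms_elimination:
  fixes F :: "(nat \<times> (nat \<Rightarrow> ('n \<Rightarrow> complex^'k) \<Rightarrow> complex)) set"
  assumes poly: "\<And>d c k. (d, c) \<in> F \<Longrightarrow> polynomial_fun (c k)"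
    and zero: "\<And>s t. (\<forall>(d, c)\<in>F. (\<Sum>k\<le>d. c k y0 * s ^ (d - k) * t ^ k) = 0) \<Longrightarrow> s = 0 \<and> t = 0"
  shows "\<exists>m. polynomial_fun m \<and> m y0 \<noteq> 0 \<and> (\<forall>y s t. m y \<noteq> 0 \<longrightarrow>
    (\<forall>(d, c)\<in>F. (\<Sum>k\<le>d. c k y * s ^ (d - k) * t ^ k) = 0) \<longrightarrow> s = 0 \<and> t = 0)"
proof -
  define F' where "F' y = (\<lambda>(d, c). (d, \<lambda>k. c k y)) ` F" for y
  have "\<exists>N. \<forall>z. annihilates (F' y0) N z \<longrightarrow> (\<forall>k\<le>N. z k = 0)"
    by (rule annihilates_eq_0) (auto simp: F'_def intro!: zero)
  then obtain N where N: "\<And>z k. annihilates (F' y0) N z \<Longrightarrow> k \<le> N \<Longrightarrow> z k = 0"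
    by blast
  \<comment> \<open>The row of the form with coefficients \<open>c\<close>, multiplied by
    \<open>t ^ a\<close> and by the power of \<open>s\<close> that raises the degree to
    \<open>N\<close>.\<close>
  define row where "row d c a k = (if a \<le> k \<and> k \<le> a + d then c (k - a) else (\<lambda>_. 0))"
    for d a k and c :: "nat \<Rightarrow> ('n \<Rightarrow> complex^'k) \<Rightarrow> complex"
  define V where "V = {row d c a | d c a. (d, c) \<in> F \<and> a + d \<le> N}"
  have row: "(\<Sum>k<Suc N. row d c a k y * z k) = (\<Sum>k\<le>d. c k y * z (k + a))" if "a + d \<le> N" for d c a y z
  proof -
    have "(\<Sum>k<Suc N. row d c a k y * z k) = (\<Sum>k\<in>{0+a..d+a}. row d c a k y * z k)"
      using that by (intro sum.mono_neutral_right) (auto simp: row_def)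
    also have "\<dots> = (\<Sum>k=0..d. c k y * z (k + a))"
      by (subst sum.shift_bounds_cl_nat_ivl) (auto simp: row_def intro!: sum.cong)
    finally show ?thesis by (simp add: atLeast0AtMost)
  qed
  have V: "(\<forall>v\<in>V. (\<Sum>k<Suc N. v k y * z k) = 0) \<longleftrightarrow> annihilates (F' y) N z" for y z
    unfolding V_def annihilates_def F'_def by (fastforce simp: row simp del: sum.lessThan_Suc)
  have "\<exists>m. polynomial_fun m \<and> m y0 \<noteq> 0 \<and> (\<forall>y z. m y \<noteq> 0 \<longrightarrow>
    (\<forall>v\<in>V. (\<Sum>k<Suc N. v k y * z k) = 0) \<longrightarrow> (\<forall>k<Suc N. z k = 0))"
  proof (rule linear_system_elimination[where G = "\<lambda>v. \<forall>k. polynomial_fun (v k)"])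
    show "\<forall>v\<in>V. \<forall>k. polynomial_fun (v k)"
      unfolding V_def by (auto simp: row_def intro: poly polynomial_fun_intros)
    show "\<And>z. \<forall>v\<in>V. (\<Sum>k<Suc N. v k y0 * z k) = 0 \<Longrightarrow> \<forall>k<Suc N. z k = 0"
      using N unfolding V by auto
  qed (auto intro!: polynomial_fun.intros polynomial_fun_diff)
  then obtain m where m: "polynomial_fun m" "m y0 \<noteq> 0" 
    "\<And>y z k. m y \<noteq> 0 \<Longrightarrow> annihilates (F' y) N z \<Longrightarrow> k \<le> N \<Longrightarrow> z k = 0"
    unfolding V by (metis less_Suc_eq_le)
  have "s = 0 \<and> t = 0" if "m y \<noteq> 0" and
    0: "\<forall>(d, c)\<in>F. (\<Sum>k\<le>d. c k y * s ^ (d - k) * t ^ k) = 0" for y s t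
  proof -
    have "(\<Sum>k\<le>d. c k y * (s ^ (N - (k + a)) * t ^ (k + a))) = 0" 
      if "(d, c) \<in> F" "a + d \<le> N" for a d c
    proof -
      have "(\<Sum>k\<le>d. c k y * (s ^ (N - (k + a)) * t ^ (k + a))) =
        (\<Sum>k\<le>d. s ^ (N - (a + d)) * t ^ a * (c k y * s ^ (d - k) * t ^ k))"
      proof (intro sum.cong refl)
        fix k assume "k \<in> {..d}"
        then have "N - (k + a) = (N - (a + d)) + (d - k)" using that by auto
        then show "c k y * (s ^ (N - (k + a)) * t ^ (k + a)) =
          s ^ (N - (a + d)) * t ^ a * (c k y * s ^ (d - k) * t ^ k)"
          by (simp only: power_add) (simp add: ac_simps)
      qed
      also have "\<dots> = 0" using 0 that by (auto simp flip: sum_distrib_left)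
      finally show ?thesis .
    qed
    then have "annihilates (F' y) N (\<lambda>k. s ^ (N - k) * t ^ k)"
      unfolding annihilates_def F'_def by auto
    \<comment> \<open>Entry 0 of this kernel vector is \<open>s ^ N\<close> and entry
      \<open>N\<close> is \<open>t ^ N\<close>.\<close>
    from m(3)[OF \<open>m y \<noteq> 0\<close> this, of 0] m(3)[OF \<open>m y \<noteq> 0\<close> this, of N]
    show ?thesis by auto
  qed
  then show ?thesis using m by blast
qed

section \<open>Binary forms with polynomial coefficients\<close>

inductive form :: "nat \<Rightarrow> (('n \<Rightarrow> complex^'k) \<Rightarrow> complex \<Rightarrow> complex \<Rightarrow> complex) \<Rightarrow> bool" where
  formI: "(\<And>k. polynomial_fun (c k)) \<Longrightarrow> form d (\<lambda>v s t. \<Sum>k\<le>d. c k v * s ^ (d - k) * t ^ k)"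

lemma form_0: "form d (\<lambda>v s t. 0)"
  using formI[of "\<lambda>_ _. 0"] by (simp add: polynomial_fun.const)

lemma form_add: "form d f \<Longrightarrow> form d g \<Longrightarrow> form d (\<lambda>v s t. f v s t + g v s t)"
proof (elim form.cases, goal_cases)
  case (1 c _ e _)
  then show ?case
    using formI[of "\<lambda>k v. c k v + e k v" d]
    by (simp add: sum.distrib algebra_simps polynomial_fun.add)
qed

lemma form_sum: "(\<And>x. x \<in> A \<Longrightarrow> form d (f x)) \<Longrightarrow> form d (\<lambda>v s t. \<Sum>x\<in>A. f x v s t)"
  by (induction A rule: infinite_finite_induct) (auto intro: form_0 form_add)

lemma form_monomial:
  assumes "polynomial_fun c"
  shows "form (a + b) (\<lambda>v s t. c v * s ^ a * t ^ b)"
proof -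
  have "form (a + b) (\<lambda>v s t. \<Sum>k\<le>a+b. (if k = b then c else (\<lambda>_. 0)) v * s ^ (a + b - k) * t ^ k)"
    using assms by (intro formI) (auto intro: polynomial_fun.intros)
  also have "(\<lambda>v s t. \<Sum>k\<le>a+b. (if k = b then c else (\<lambda>_. 0)) v * s ^ (a + b - k) * t ^ k) =
      (\<lambda>v s t. \<Sum>k\<le>a+b. if k = b then c v * s ^ a * t ^ b else 0)"
    by (intro ext sum.cong) auto
  finally show ?thesis by simp
qed

lemma form_mult:
  assumes "form d f" "form e g"
  shows "form (d + e) (\<lambda>v s t. f v s t * g v s t)"
proof -
  obtain a where a: "\<And>k. polynomial_fun (a k)" "f = (\<lambda>v s t. \<Sum>k\<le>d. a k v * s ^ (d - k) * t ^ k)"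
    using assms(1) by (auto elim: form.cases)
  obtain b where b: "\<And>k. polynomial_fun (b k)" "g = (\<lambda>v s t. \<Sum>k\<le>e. b k v * s ^ (e - k) * t ^ k)"
    using assms(2) by (auto elim: form.cases)
  have "form (d + e) (\<lambda>v s t. \<Sum>k\<le>d. \<Sum>l\<le>e. (a k v * b l v) * s ^ ((d - k) + (e - l)) * t ^ (k + l))"
  proof (intro form_sum)
    fix k l assume "k \<in> {..d}" "l \<in> {..e}"
    then have *: "((d - k) + (e - l)) + (k + l) = d + e" by auto
    show "form (d + e) (\<lambda>v s t. (a k v * b l v) * s ^ ((d - k) + (e - l)) * t ^ (k + l))"
      using form_monomial[OF polynomial_fun.mult[OF a(1)[of k] b(1)[of l]], of "(d - k) + (e - l)" "k + l"]
      unfolding * .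
  qed
  also have "(\<lambda>v s t. \<Sum>k\<le>d. \<Sum>l\<le>e. (a k v * b l v) * s ^ ((d - k) + (e - l)) * t ^ (k + l)) =
      (\<lambda>v s t. f v s t * g v s t)"
    unfolding a(2) b(2) sum_product by (simp only: power_add ac_simps)
  finally show ?thesis .
qed

section \<open>Algebraic sets and their projections\<close>

text \<open>Closedness is phrased as separation of single points because elimination yields just
  that: one polynomial for each point outside, rather than a list of equations for the
  image.\<close>

definition algebraic_set :: "('n \<Rightarrow> complex^'k) set \<Rightarrow> bool" where
  "algebraic_set S \<longleftrightarrow>
     (\<forall>v. v \<notin> S \<longrightarrow> (\<exists>m. polynomial_fun m \<and> m v \<noteq> 0 \<and> (\<forall>w\<in>S. m w = 0)))"

lemma algebraic_setI:
  assumes "\<And>v. v \<notin> S \<Longrightarrow> \<exists>m. polynomial_fun m \<and> m v \<noteq> 0 \<and> (\<forall>w\<in>S. m w = 0)"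
  shows "algebraic_set S"
  using assms unfolding algebraic_set_def by blast

lemma algebraic_setE:
  assumes "algebraic_set S" "v \<notin> S"
  obtains m where "polynomial_fun m" "m v \<noteq> 0" "\<And>w. w \<in> S \<Longrightarrow> m w = 0"
  using assms unfolding algebraic_set_def by blast

lemma algebraic_set_zeros: "polynomial_fun p \<Longrightarrow> algebraic_set {v. p v = 0}"
  by (rule algebraic_setI) auto

lemma algebraic_set_INT: "(\<And>x. x \<in> A \<Longrightarrow> algebraic_set (S x)) \<Longrightarrow> algebraic_set (\<Inter>x\<in>A. S x)"
  unfolding algebraic_set_def by (metis INT_E INT_I)

lemma algebraic_set_Int: "algebraic_set S \<Longrightarrow> algebraic_set T \<Longrightarrow> algebraic_set (S \<inter> T)"
  unfolding algebraic_set_def by (metis Int_iff)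

lemma algebraic_set_vimage:
  assumes "algebraic_set S" "\<And>i j. polynomial_fun (\<lambda>v. \<phi> v i $ j)"
  shows "algebraic_set {v. \<phi> v \<in> S}"
proof (rule algebraic_setI)
  fix v assume "v \<notin> {v. \<phi> v \<in> S}"
  then obtain m where "polynomial_fun m" "m (\<phi> v) \<noteq> 0" "\<And>w. w \<in> S \<Longrightarrow> m w = 0"
    using algebraic_setE[OF assms(1)] by blast
  then show "\<exists>m. polynomial_fun m \<and> m v \<noteq> 0 \<and> (\<forall>w\<in>{v. \<phi> v \<in> S}. m w = 0)"
    using polynomial_fun_compose[of m \<phi>] assms(2) by (intro exI[of _ "\<lambda>v. m (\<phi> v)"]) auto
qed

definition scale_set :: "('n \<times> 'k) set \<Rightarrow> complex \<Rightarrow> ('n \<Rightarrow> complex^'k) \<Rightarrow> 'n \<Rightarrow> complex^'k" where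
  "scale_set B s v = (\<lambda>i. \<chi> k. if (i, k) \<in> B then s * v i $ k else v i $ k)"

text \<open>With the entries in \<open>B\<close> and at \<open>j\<close> read as homogeneous
  coordinates, this is the point with parameters \<open>(s : t)\<close> on the line from the
  \<open>B\<close>-part of \<open>v\<close> to the coordinate point \<open>j\<close>. All other
  entries are parameters.\<close>

definition join_point ::
    "('n \<times> 'k) set \<Rightarrow> 'n \<times> 'k \<Rightarrow> complex \<Rightarrow> complex \<Rightarrow> ('n \<Rightarrow> complex^'k) \<Rightarrow> 'n \<Rightarrow> complex^'k" where
  "join_point B j s t v =
     (\<lambda>i. \<chi> k. if (i, k) = j then t else if (i, k) \<in> B then s * v i $ k else v i $ k)"

text \<open>The variable \<open>r\<close> does the bookkeeping: the coefficient of
  \<open>r ^ d\<close> collects the part of \<open>f\<close> that has degree \<open>d\<close> in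
  \<open>(s, t)\<close>.\<close>

lemma join_point_form_expansion:
  assumes "polynomial_fun f"
  shows "\<exists>K. (\<forall>d. form d (\<lambda>v s t. coeff (K v s t) d)) \<and>
    (\<forall>v s t r. f (join_point B j (r * s) (r * t) v) = poly (K v s t) r)"
  using assms
proof induction
  case (const c)
  have "form d (\<lambda>(v :: 'a \<Rightarrow> complex^'b) s t. coeff [:c:] d)" for d
    using form_monomial[OF polynomial_fun.const[of c], of 0 0] by (cases d) (auto intro: form_0)
  then show ?case by (intro exI[of _ "\<lambda>_ _ _. [:c:]"]) simp
next
  case (coord i k)
  define K where "K v s t = (if (i, k) = j then [:0, t:]
    else if (i, k) \<in> B then [:0, s * v i $ k:] else [:v i $ k:])" for v :: "'a \<Rightarrow> complex^'b" and s t
  have "form d (\<lambda>v s t. coeff (K v s t) d)" for d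
  proof -
    have 1: "form (Suc 0) (\<lambda>(v :: 'a \<Rightarrow> complex^'b) s t. t)"
      using form_monomial[OF polynomial_fun.const[of 1], of 0 1] by simp
    have 2: "form (Suc 0) (\<lambda>v s t. s * v i $ k)"
      using form_monomial[of "\<lambda>v. v i $ k" 1 0] by (auto intro: polynomial_fun.intros simp: mult.commute)
    have 3: "form 0 (\<lambda>v s t. v i $ k)"
      using form_monomial[of "\<lambda>v. v i $ k" 0 0] by (auto intro: polynomial_fun.intros)
    consider "d = 0" | "d = Suc 0" | n where "d = Suc (Suc n)"
      by (metis nat.exhaust)
    then show ?thesis
      by cases (cases "(i, k) = j"; cases "(i, k) \<in> B"; simp add: K_def form_0 1 2 3)+
  qed
  moreover have "join_point B j (r * s) (r * t) v i $ k = poly (K v s t) r" for v s t r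
    by (simp add: join_point_def K_def)
  ultimately show ?case by blast
next
  case (add p q)
  then obtain K L where
    "\<And>d. form d (\<lambda>v s t. coeff (K v s t) d)" 
    "\<And>v s t r. p (join_point B j (r * s) (r * t) v) = poly (K v s t) r"
    "\<And>d. form d (\<lambda>v s t. coeff (L v s t) d)" 
    "\<And>v s t r. q (join_point B j (r * s) (r * t) v) = poly (L v s t) r"
    by blast
  then show ?case
    by (intro exI[of _ "\<lambda>v s t. K v s t + L v s t"]) (auto intro: form_add)
next
  case (mult p q)
  then obtain K L where
    KL: "\<And>d. form d (\<lambda>v s t. coeff (K v s t) d)" 
    "\<And>v s t r. p (join_point B j (r * s) (r * t) v) = poly (K v s t) r"
    "\<And>d. form d (\<lambda>v s t. coeff (L v s t) d)" 
    "\<And>v s t r. q (join_point B j (r * s) (r * t) v) = poly (L v s t) r"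
    by blast
  have "form d (\<lambda>v s t. coeff (K v s t) e * coeff (L v s t) (d - e))" if "e \<le> d" for d e
    using form_mult[OF KL(1)[of e] KL(3)[of "d - e"]] that by simp
  then show ?case
    using KL
    by (intro exI[of _ "\<lambda>v s t. K v s t * L v s t"]) (auto simp: coeff_mult intro!: form_sum)
qed

text \<open>Invariance under scaling \<open>(s, t)\<close> lets every polynomial vanishing on
  \<open>S\<close> be split into forms in \<open>(s, t)\<close> that vanish there as well. Hence
  forms alone cut out \<open>S\<close> on each of these lines, and \<open>forms_elimination\<close>
  applies.\<close>

lemma algebraic_set_join:
  assumes S: "algebraic_set S"
    and inv: "\<And>v s t r. r \<noteq> 0 \<Longrightarrow> join_point B j s t v \<in> S \<Longrightarrow> join_point B j (r * s) (r * t) v \<in> S"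
  shows "algebraic_set {v. \<exists>s t. (s \<noteq> 0 \<or> t \<noteq> 0) \<and> join_point B j s t v \<in> S}"
    (is "algebraic_set ?T")
proof (rule algebraic_setI)
  fix y0 assume y0: "y0 \<notin> ?T"
  \<comment> \<open>All forms that vanish on \<open>S\<close> are taken at once; an infinite family
    is harmless for the elimination.\<close>
  define F where "F = {(d, c). (\<forall>k. polynomial_fun (c k)) \<and>
    (\<forall>v s t. join_point B j s t v \<in> S \<longrightarrow> (\<Sum>k\<le>d. c k v * s ^ (d - k) * t ^ k) = 0)}"
  have F: "join_point B j s t y \<in> S"
    if 0: "\<forall>(d, c)\<in>F. (\<Sum>k\<le>d. c k y * s ^ (d - k) * t ^ k) = 0" for y s t
  proof (rule ccontr)
    assume "join_point B j s t y \<notin> S"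
    then obtain f where f: "polynomial_fun f" "f (join_point B j s t y) \<noteq> 0" 
      "\<And>w. w \<in> S \<Longrightarrow> f w = 0"
      using algebraic_setE[OF S] by blast
    obtain K where K: "\<And>d. form d (\<lambda>v s t. coeff (K v s t) d)"
      "\<And>v s t r. f (join_point B j (r * s) (r * t) v) = poly (K v s t) r"
      using join_point_form_expansion[OF f(1), of B j] by blast
    \<comment> \<open>By the scaling invariance this polynomial vanishes at every nonzero
      \<open>r\<close>.\<close>
    have K0: "K v s t = 0" if "join_point B j s t v \<in> S" for v s t
    proof (rule ccontr)
      assume "K v s t \<noteq> 0"
      then obtain r where "r \<notin> {0}" "poly (K v s t) r \<noteq> 0"
        using poly_ex_nonzero_both[of "K v s t" "K v s t" "{0}"] by blast
      then show False using K(2)[of r s t v] f(3) inv that by auto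
    qed
    have "coeff (K y s t) d = 0" for d
    proof -
      obtain c where c: "\<And>k. polynomial_fun (c k)" 
        "(\<lambda>v s t. coeff (K v s t) d) = (\<lambda>v s t. \<Sum>k\<le>d. c k v * s ^ (d - k) * t ^ k)"
        by (rule form.cases[OF K(1)[of d]]) blast
      have c': "coeff (K v s t) d = (\<Sum>k\<le>d. c k v * s ^ (d - k) * t ^ k)" for v s t
        using c(2) by meson
      have "(d, c) \<in> F"
        unfolding F_def using c(1) K0 by (auto simp flip: c')
      then show ?thesis using 0 unfolding c' by blast
    qed
    then have "K y s t = 0" by (simp add: poly_eq_iff)
    then show False using f(2) K(2)[of 1 s t y] by simp
  qed
  have "\<exists>m. polynomial_fun m \<and> m y0 \<noteq> 0 \<and> (\<forall>y s t. m y \<noteq> 0 \<longrightarrow>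
    (\<forall>(d, c)\<in>F. (\<Sum>k\<le>d. c k y * s ^ (d - k) * t ^ k) = 0) \<longrightarrow> s = 0 \<and> t = 0)"
  proof (rule forms_elimination)
    show "\<And>d c k. (d, c) \<in> F \<Longrightarrow> polynomial_fun (c k)" by (simp add: F_def)
    fix s t
    assume "\<forall>(d, c)\<in>F. (\<Sum>k\<le>d. c k y0 * s ^ (d - k) * t ^ k) = 0"
    then show "s = 0 \<and> t = 0" using F y0 by blast
  qed
  then obtain m where m: "polynomial_fun m" "m y0 \<noteq> 0"
    "\<And>y s t. m y \<noteq> 0 \<Longrightarrow> (\<forall>(d, c)\<in>F. (\<Sum>k\<le>d. c k y * s ^ (d - k) * t ^ k) = 0) \<Longrightarrow> s = 0 \<and> t = 0"
    by blast
  have "m w = 0" if "w \<in> ?T" for w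
  proof (rule ccontr)
    assume "m w \<noteq> 0"
    moreover obtain s t where st: "s \<noteq> 0 \<or> t \<noteq> 0" "join_point B j s t w \<in> S"
      using \<open>w \<in> ?T\<close> by blast
    have "\<forall>(d, c)\<in>F. (\<Sum>k\<le>d. c k w * s ^ (d - k) * t ^ k) = 0"
      using st(2) unfolding F_def by blast
    ultimately show False using m(3) st(1) by blast
  qed
  then show "\<exists>m. polynomial_fun m \<and> m y0 \<noteq> 0 \<and> (\<forall>w\<in>?T. m w = 0)"
    using m by blast
qed

text \<open>Induction step: away from the coordinate point \<open>j\<close> the projection from it lowers the
  dimension, and replacing a point by the join with \<open>j\<close> makes the exceptional point harmless.
  So only projections along a projective line occur.\<close>

lemma algebraic_set_project_coordinates:
  fixes S :: "('n \<Rightarrow> complex^'k) set"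
  assumes "finite B" "B \<noteq> {}" "algebraic_set S"
    and "\<And>v r. r \<noteq> 0 \<Longrightarrow> v \<in> S \<Longrightarrow> scale_set B r v \<in> S"
  shows "algebraic_set {v. \<exists>w\<in>S. (\<forall>i k. (i, k) \<notin> B \<longrightarrow> w i $ k = v i $ k) \<and>
    (\<exists>(i, k)\<in>B. w i $ k \<noteq> 0)}"
  using assms
proof (induction B arbitrary: S rule: finite_ne_induct)
  case (singleton j)
  obtain i0 k0 where j: "j = (i0, k0)" by fastforce
  \<comment> \<open>A single nonzero homogeneous coordinate can be scaled to 1, so eliminating it
    amounts to substituting 1.\<close>
  have "{v. \<exists>w\<in>S. (\<forall>i k. (i, k) \<notin> {j} \<longrightarrow> w i $ k = v i $ k) \<and> (\<exists>(i, k)\<in>{j}. w i $ k \<noteq> 0)} =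
    {v. join_point {} j 1 1 v \<in> S}" (is "?L = ?R")
  proof (intro equalityI subsetI)
    fix v assume "v \<in> ?L"
    then obtain w where w: "w \<in> S" "\<And>i k. (i, k) \<noteq> j \<Longrightarrow> w i $ k = v i $ k" "w i0 $ k0 \<noteq> 0"
      using j by auto
    have "scale_set {j} (1 / w i0 $ k0) w = join_point {} j 1 1 v"
      using w by (auto simp: scale_set_def join_point_def fun_eq_iff vec_eq_iff j)
    then show "v \<in> ?R" using singleton.prems(2)[OF _ w(1)] w(3)
      by (metis (mono_tags, lifting) divide_eq_0_iff mem_Collect_eq zero_neq_one)
  next
    fix v assume "v \<in> ?R"
    then show "v \<in> ?L"
      by (intro CollectI bexI[of _ "join_point {} j 1 1 v"]) (auto simp: join_point_def j)
  qed
  moreover have "algebraic_set {v. join_point {} j 1 1 v \<in> S}"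
  proof (rule algebraic_set_vimage[OF singleton.prems(1)])
    show "polynomial_fun (\<lambda>v. join_point {} j 1 1 v i $ k)" for i k
      by (cases "(i, k) = j") (simp_all add: join_point_def polynomial_fun.intros)
  qed
  ultimately show ?case by simp
next
  case (insert j B)
  obtain i0 k0 where j: "j = (i0, k0)" by fastforce
  define T where "T = {v. \<exists>s t. (s \<noteq> 0 \<or> t \<noteq> 0) \<and> join_point B j s t v \<in> S}"
  have T: "algebraic_set T"
    unfolding T_def
  proof (rule algebraic_set_join[OF insert.prems(1)])
    fix v s t r assume "r \<noteq> (0::complex)" "join_point B j s t v \<in> S"
    moreover have "scale_set (insert j B) r (join_point B j s t v) = join_point B j (r * s) (r * t) v"
      using insert.hyps by (auto simp: scale_set_def join_point_def fun_eq_iff vec_eq_iff)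
    ultimately show "join_point B j (r * s) (r * t) v \<in> S"
      using insert.prems(2) by metis
  qed
  have inv: "scale_set B r v \<in> T" if rv: "r \<noteq> 0" "v \<in> T" for r v
  proof -
    obtain s t where st: "s \<noteq> 0 \<or> t \<noteq> 0" "join_point B j s t v \<in> S"
      using rv(2) unfolding T_def by blast
    have "join_point B j (s / r) t (scale_set B r v) = join_point B j s t v"
      using rv(1) by (auto simp: scale_set_def join_point_def fun_eq_iff vec_eq_iff)
    then show ?thesis
      unfolding T_def using st rv(1) by (intro CollectI exI[of _ "s / r"] exI[of _ t]) auto
  qed
  have "{v. \<exists>w\<in>S. (\<forall>i k. (i, k) \<notin> insert j B \<longrightarrow> w i $ k = v i $ k) \<and>
      (\<exists>(i, k)\<in>insert j B. w i $ k \<noteq> 0)} =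
    {v. \<exists>w\<in>T. (\<forall>i k. (i, k) \<notin> B \<longrightarrow> w i $ k = v i $ k) \<and> (\<exists>(i, k)\<in>B. w i $ k \<noteq> 0)}" (is "?L = ?R")
  proof (intro equalityI subsetI)
    fix v assume "v \<in> ?L"
    then obtain w where w: "w \<in> S" "\<And>i k. (i, k) \<notin> insert j B \<Longrightarrow> w i $ k = v i $ k"
      "\<exists>(i, k)\<in>insert j B. w i $ k \<noteq> 0" by blast
    show "v \<in> ?R"
    proof (cases "\<exists>(i, k)\<in>B. w i $ k \<noteq> 0")
      case True
      \<comment> \<open>Restoring entry \<open>j\<close> from \<open>v\<close> makes
        \<open>w'\<close> agree with \<open>v\<close> outside \<open>B\<close>; the lost value comes
        back as the parameter \<open>t\<close>, with \<open>s = 1\<close>.\<close>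
      define w' where "w' = (\<lambda>i. \<chi> k. if (i, k) = j then v i $ k else w i $ k)"
      have "join_point B j 1 (w i0 $ k0) w' = w"
        using insert.hyps by (auto simp: join_point_def w'_def fun_eq_iff vec_eq_iff j)
      then have "w' \<in> T"
        unfolding T_def using w(1) by (intro CollectI exI[of _ 1] exI[of _ "w i0 $ k0"]) auto
      moreover have "w' i $ k = v i $ k" if "(i, k) \<notin> B" for i k
        using that w(2) by (simp add: w'_def)
      moreover have "\<exists>(i, k)\<in>B. w' i $ k \<noteq> 0"
      proof -
        obtain i k where "(i, k) \<in> B" "w i $ k \<noteq> 0" using True by blast
        moreover from this have "w' i $ k = w i $ k" using insert.hyps by (auto simp: w'_def)
        ultimately show ?thesis by (auto intro!: bexI[of _ "(i, k)"])
      qed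
      ultimately show ?thesis by blast
    next
      case False
      then have nz: "w i0 $ k0 \<noteq> 0" and z: "\<And>i k. (i, k) \<in> B \<Longrightarrow> w i $ k = 0" using w(3) j by auto
      \<comment> \<open>Here \<open>w\<close> is the coordinate point \<open>j\<close>. The
        parameter \<open>s = 0\<close> erases the entries in \<open>B\<close>, so they may be filled
        arbitrarily; 1 makes them nonzero.\<close>
      define w' where "w' = (\<lambda>i. \<chi> k. if (i, k) \<in> B then 1 else v i $ k)"
      have "join_point B j 0 (w i0 $ k0) w' = w"
        using insert.hyps w(2) z by (auto simp: join_point_def w'_def fun_eq_iff vec_eq_iff j)
      then have "w' \<in> T"
        unfolding T_def using w(1) nz by (intro CollectI exI[of _ 0] exI[of _ "w i0 $ k0"]) auto
      moreover obtain i k where "(i, k) \<in> B"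
        using insert.hyps by fastforce
      then have "\<exists>(i, k)\<in>B. w' i $ k \<noteq> 0"
        by (auto simp: w'_def intro!: bexI[of _ "(i, k)"])
      ultimately show ?thesis by (intro CollectI bexI[of _ w']) (auto simp: w'_def)
    qed
  next
    fix v assume "v \<in> ?R"
    then obtain w s t where w: "\<And>i k. (i, k) \<notin> B \<Longrightarrow> w i $ k = v i $ k"
      "\<exists>(i, k)\<in>B. w i $ k \<noteq> 0" "s \<noteq> 0 \<or> t \<noteq> 0" "join_point B j s t w \<in> S"
      unfolding T_def by blast
    have "\<exists>(i, k)\<in>insert j B. join_point B j s t w i $ k \<noteq> 0"
    proof (cases "t = 0")
      case True
      obtain i k where "(i, k) \<in> B" "w i $ k \<noteq> 0" using w(2) by blast
      then show ?thesis
        using w(3) True insert.hyps by (auto simp: join_point_def intro!: bexI[of _ "(i, k)"])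
    next
      case False
      then show ?thesis by (auto simp: join_point_def j)
    qed
    moreover have "\<forall>i k. (i, k) \<notin> insert j B \<longrightarrow> join_point B j s t w i $ k = v i $ k"
      using w(1) by (auto simp: join_point_def)
    ultimately show "v \<in> ?L" using w(4) by blast
  qed
  then show ?case using insert.IH[OF T inv] by simp
qed

text \<open>Properness of a product of projective spaces, stated on affine cones and proved one
  factor at a time. Blocks outside \<open>I\<close> are parameters; for a block in \<open>I\<close>,
  being nonzero makes it represent a projective point.\<close>

lemma algebraic_set_project_blocks:
  fixes S :: "('n \<Rightarrow> complex^'k) set"
  assumes "finite I" "algebraic_set S"
    and "\<And>v i r. i \<in> I \<Longrightarrow> r \<noteq> 0 \<Longrightarrow> v \<in> S \<Longrightarrow> v(i := r *s v i) \<in> S"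
  shows "algebraic_set {v. \<exists>w\<in>S. (\<forall>i. i \<notin> I \<longrightarrow> w i = v i) \<and> (\<forall>i\<in>I. w i \<noteq> 0)}"
  using assms
proof (induction I)
  case empty
  have "{v. \<exists>w\<in>S. (\<forall>i. i \<notin> {} \<longrightarrow> w i = v i) \<and> (\<forall>i\<in>{}. w i \<noteq> 0)} = S"
    by (auto simp: fun_eq_iff[symmetric])
  then show ?case using empty by simp
next
  case (insert j I)
  define T where "T = {v. \<exists>w\<in>S. (\<forall>i. i \<notin> I \<longrightarrow> w i = v i) \<and> (\<forall>i\<in>I. w i \<noteq> 0)}"
  have T: "algebraic_set T"
    unfolding T_def using insert.prems by (intro insert.IH) auto
  define B where "B = {j} \<times> (UNIV :: 'k set)"
  have scale: "scale_set B r v = v(j := r *s v j)" for r and v :: "'n \<Rightarrow> complex^'k"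
    by (auto simp: scale_set_def B_def fun_eq_iff vec_eq_iff)
  have "algebraic_set {v. \<exists>w\<in>T. (\<forall>i k. (i, k) \<notin> B \<longrightarrow> w i $ k = v i $ k) \<and>
    (\<exists>(i, k)\<in>B. w i $ k \<noteq> 0)}"
  proof (rule algebraic_set_project_coordinates[OF _ _ T])
    show "finite B" "B \<noteq> {}" by (auto simp: B_def)
    fix v r assume r: "r \<noteq> (0::complex)" and "v \<in> T"
    then obtain w where "w \<in> S" "\<forall>i. i \<notin> I \<longrightarrow> w i = v i" "\<forall>i\<in>I. w i \<noteq> 0"
      unfolding T_def by blast
    moreover from this have "w j = v j"
      using insert.hyps by blast
    moreover have "w(j := r *s w j) \<in> S"
      using insert.prems(2)[of j r w] r \<open>w \<in> S\<close> by blast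
    ultimately show "scale_set B r v \<in> T"
      unfolding T_def scale using insert.hyps
      by (intro CollectI bexI[of _ "w(j := r *s w j)"]) auto
  qed
  moreover have "{v. \<exists>w\<in>T. (\<forall>i k. (i, k) \<notin> B \<longrightarrow> w i $ k = v i $ k) \<and> (\<exists>(i, k)\<in>B. w i $ k \<noteq> 0)} =
    {v. \<exists>w\<in>S. (\<forall>i. i \<notin> insert j I \<longrightarrow> w i = v i) \<and> (\<forall>i\<in>insert j I. w i \<noteq> 0)}" (is "?L = ?R")
  proof -
    have "?L = {v. \<exists>w\<in>T. (\<forall>i. i \<noteq> j \<longrightarrow> w i = v i) \<and> w j \<noteq> 0}"
      by (auto simp: B_def vec_eq_iff)
    also have "\<dots> = ?R"
    proof (intro equalityI subsetI)
      fix v assume "v \<in> {v. \<exists>w\<in>T. (\<forall>i. i \<noteq> j \<longrightarrow> w i = v i) \<and> w j \<noteq> 0}"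
      then obtain w where "w \<in> T" "\<forall>i. i \<noteq> j \<longrightarrow> w i = v i" "w j \<noteq> 0" by blast
      then obtain u where u: "u \<in> S" "\<forall>i. i \<notin> I \<longrightarrow> u i = w i" "\<forall>i\<in>I. u i \<noteq> 0"
        unfolding T_def by blast
      moreover have "\<forall>i. i \<notin> insert j I \<longrightarrow> u i = v i"
        using u(2) \<open>\<forall>i. i \<noteq> j \<longrightarrow> w i = v i\<close> by simp
      moreover have "\<forall>i\<in>insert j I. u i \<noteq> 0"
        using u \<open>w j \<noteq> 0\<close> insert.hyps by simp
      ultimately show "v \<in> ?R" by blast
    next
      fix v assume "v \<in> ?R"
      then obtain w where w: "w \<in> S" "\<forall>i. i \<notin> insert j I \<longrightarrow> w i = v i" "\<forall>i\<in>insert j I. w i \<noteq> 0"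
        by blast
      then have "v(j := w j) \<in> T"
        unfolding T_def using insert.hyps by (intro CollectI bexI[of _ w]) auto
      then show "v \<in> {v. \<exists>w\<in>T. (\<forall>i. i \<noteq> j \<longrightarrow> w i = v i) \<and> w j \<noteq> 0}"
        using w(3) by (intro CollectI bexI[of _ "v(j := w j)"]) auto
    qed
    finally show ?thesis .
  qed
  ultimately show ?case by simp
qed

section \<open>Pluecker coordinates\<close>

text \<open>For \<open>p = wedge u v\<close>, the contraction of \<open>p\<close> with the covector \<open>a\<close> is
  \<open>a(u) v - a(v) u\<close>, so it sweeps out the line; \<open>incidence p x\<close> lists the coordinates of
  \<open>x \<and> u \<and> v\<close>; and \<open>quadric\<close> is the Pluecker relation.\<close>

definition contraction :: "complex^6 \<Rightarrow> complex^4 \<Rightarrow> complex^4" where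
  "contraction p a = vector
     [- a$2 * p$1 - a$3 * p$2 - a$4 * p$3, a$1 * p$1 - a$3 * p$4 - a$4 * p$5,
      a$1 * p$2 + a$2 * p$4 - a$4 * p$6, a$1 * p$3 + a$2 * p$5 + a$3 * p$6]"

definition incidence :: "complex^6 \<Rightarrow> complex^4 \<Rightarrow> complex^4" where
  "incidence p x = vector
     [x$1 * p$4 - x$2 * p$2 + x$3 * p$1, x$1 * p$5 - x$2 * p$3 + x$4 * p$1,
      x$1 * p$6 - x$3 * p$3 + x$4 * p$2, x$2 * p$6 - x$3 * p$5 + x$4 * p$4]"

definition quadric :: "complex^6 \<Rightarrow> complex" where
  "quadric p = p$1 * p$6 - p$2 * p$5 + p$3 * p$4"

lemma contraction_nth [simp]:
  "contraction p a $ 1 = - a$2 * p$1 - a$3 * p$2 - a$4 * p$3"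
  "contraction p a $ 2 = a$1 * p$1 - a$3 * p$4 - a$4 * p$5"
  "contraction p a $ 3 = a$1 * p$2 + a$2 * p$4 - a$4 * p$6"
  "contraction p a $ 4 = a$1 * p$3 + a$2 * p$5 + a$3 * p$6"
  by (simp_all add: contraction_def vector_def)

lemma incidence_nth [simp]:
  "incidence p x $ 1 = x$1 * p$4 - x$2 * p$2 + x$3 * p$1"
  "incidence p x $ 2 = x$1 * p$5 - x$2 * p$3 + x$4 * p$1"
  "incidence p x $ 3 = x$1 * p$6 - x$3 * p$3 + x$4 * p$2"
  "incidence p x $ 4 = x$2 * p$6 - x$3 * p$5 + x$4 * p$4"
  by (simp_all add: incidence_def vector_def)

lemma incidence_scale: "incidence (c *s p) x = c *s incidence p x"
  by (simp add: vec_eq_iff forall_4 algebra_simps)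

lemma contraction_scale: "contraction p (c *s a) = c *s contraction p a"
  by (simp add: vec_eq_iff forall_4 algebra_simps)

lemma wedge_scale: "wedge (c *s u) v = c *s wedge u v"
  by (simp add: vec_eq_iff forall_6 algebra_simps)

lemma quadric_scale: "quadric (c *s p) = c\<^sup>2 * quadric p"
  by (simp add: quadric_def power2_eq_square algebra_simps)

lemma quadric_wedge: "quadric (wedge u v) = 0"
  by (simp add: quadric_def algebra_simps)

lemma contraction_wedge:
  "contraction (wedge u v) a = (\<Sum>i\<in>UNIV. a$i * u$i) *s v - (\<Sum>i\<in>UNIV. a$i * v$i) *s u"
  by (simp add: vec_eq_iff forall_4 sum_4 algebra_simps)

lemma incidence_wedge_combination: "incidence (wedge u v) (a *s u + b *s v) = 0"
  by (simp add: vec_eq_iff forall_4 algebra_simps)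

text \<open>If \<open>p\<close> represents a line, both contractions lie on it, so their wedge is a
  multiple of \<open>p\<close>. Proved from the Pluecker relation alone, the formula can be used to
  show that \<open>p\<close> represents a line.\<close>

lemma contraction_eq_wedge_combination:
  assumes "quadric p = 0"
  shows "wedge (contraction p a) (contraction p b) =
    (\<Sum>i\<in>UNIV. a$i * contraction p b $ i) *s (- p)"
  using assms unfolding quadric_def
  apply (simp add: vec_eq_iff forall_6 sum_4)
  apply (intro conjI; algebra)
  done

lemma ex_contraction:
  assumes "p \<noteq> 0" "incidence p x = 0"
  shows "\<exists>a. x = contraction p a"
proof -
  have x: "x$1 * p$4 - x$2 * p$2 + x$3 * p$1 = 0" "x$1 * p$5 - x$2 * p$3 + x$4 * p$1 = 0"
    "x$1 * p$6 - x$3 * p$3 + x$4 * p$2 = 0" "x$2 * p$6 - x$3 * p$5 + x$4 * p$4 = 0"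
    using assms(2) by (simp_all add: vec_eq_iff forall_4)
  consider "p$1 \<noteq> 0" | "p$2 \<noteq> 0" | "p$3 \<noteq> 0" | "p$4 \<noteq> 0" | "p$5 \<noteq> 0" | "p$6 \<noteq> 0"
    using assms(1) by (auto simp: vec_eq_iff forall_6)
  \<comment> \<open>If \<open>p = wedge x y\<close>, a covector with \<open>a(x) = 0\<close>
    contracts \<open>p\<close> to \<open>- a(y) x\<close>. On the two coordinates belonging to a
    nonzero entry of \<open>p\<close>, the covector built from \<open>x\<close> as below kills
    \<open>x\<close> and takes minus that entry as its value at \<open>y\<close>.\<close>
  then have "\<exists>a c. c \<noteq> 0 \<and> contraction p a = c *s x"
  proof cases
    case 1
    then show ?thesis using x
      by (intro exI[of _ "vector [x$2, - x$1, 0, 0]"] exI[of _ "p$1"])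
        (simp add: vec_eq_iff forall_4 vector_def; algebra)
  next
    case 2
    then show ?thesis using x
      by (intro exI[of _ "vector [x$3, 0, - x$1, 0]"] exI[of _ "p$2"])
        (simp add: vec_eq_iff forall_4 vector_def; algebra)
  next
    case 3
    then show ?thesis using x
      by (intro exI[of _ "vector [x$4, 0, 0, - x$1]"] exI[of _ "p$3"])
        (simp add: vec_eq_iff forall_4 vector_def; algebra)
  next
    case 4
    then show ?thesis using x
      by (intro exI[of _ "vector [0, x$3, - x$2, 0]"] exI[of _ "p$4"])
        (simp add: vec_eq_iff forall_4 vector_def; algebra)
  next
    case 5
    then show ?thesis using x
      by (intro exI[of _ "vector [0, x$4, 0, - x$2]"] exI[of _ "p$5"])
        (simp add: vec_eq_iff forall_4 vector_def; algebra)
  next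
    case 6
    then show ?thesis using x
      by (intro exI[of _ "vector [0, 0, x$4, - x$3]"] exI[of _ "p$6"])
        (simp add: vec_eq_iff forall_4 vector_def; algebra)
  qed
  then obtain a c where "c \<noteq> 0" "contraction p a = c *s x" by blast
  then have "x = contraction p ((1 / c) *s a)" by (simp add: contraction_scale)
  then show ?thesis ..
qed

text \<open>Contractions with two coordinate covectors supply the spanning vectors: by
  \<open>contraction_eq_wedge_combination\<close> their wedge is an entry of a contraction times
  \<open>- p\<close>, and some such entry is nonzero.\<close>

lemma ex_wedge:
  assumes "p \<noteq> 0" "quadric p = 0"
  shows "\<exists>u v. p = wedge u v"
proof -
  have "\<exists>i j. contraction p (axis j 1) $ i \<noteq> 0"
  proof (rule ccontr)
    assume "\<not> ?thesis"
    then have "\<forall>j i. contraction p (axis j 1) $ i = 0" by blast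
    then have "p = 0" by (simp add: forall_4 axis_def vec_eq_iff forall_6)
    then show False using assms(1) by simp
  qed
  then obtain i j where ij: "contraction p (axis j 1) $ i \<noteq> 0" (is "?c \<noteq> 0") by blast
  have *: "wedge (contraction p (axis i 1)) (contraction p (axis j 1)) = ?c *s (- p)"
    by (subst contraction_eq_wedge_combination[OF assms(2)])
      (simp add: axis_def if_distrib[of "\<lambda>x. x * _"] cong: if_cong)
  have "wedge ((- 1 / ?c) *s contraction p (axis i 1)) (contraction p (axis j 1)) = p"
    unfolding wedge_scale * using ij by simp
  then show ?thesis by metis
qed

lemma vec_span_pair: "x \<in> vec.span {u, v} \<longleftrightarrow> (\<exists>a b. x = a *s u + b *s v)"
  by (auto simp: vec.span_insert vec.span_singleton algebra_simps)

lemma vec_dim_pair: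
  assumes "wedge u v \<noteq> 0"
  shows "vec.dim (vec.span {u, v}) = 2"
proof -
  have "wedge 0 v = 0" "wedge u (c *s u) = 0" for c by (simp_all add: vec_eq_iff forall_6)
  then have "u \<noteq> 0" "v \<noteq> c *s u" for c using assms by auto
  moreover from this(2) have "v \<notin> vec.span {u}" "u \<noteq> v"
    by (auto simp: vec.span_singleton) (metis vector_smult_lid)
  ultimately have "vec.independent {v, u}"
    by (simp add: vec.independent_insert)
  then show ?thesis
    using \<open>u \<noteq> v\<close> by (simp add: vec.dim_span vec.dim_eq_card_independent insert_commute)
qed

lemma Gr_ex_span:
  assumes "L \<in> Gr"
  shows "\<exists>u v. wedge u v \<noteq> 0 \<and> L = vec.span {u, v}"
proof -
  have L: "vec.subspace L" "vec.dim L = 2"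
    using assms by (auto simp: Gr_def)
  obtain B where B: "B \<subseteq> L" "vec.independent B" "L \<subseteq> vec.span B" "card B = 2"
    using vec.basis_exists[of L] L(2) by metis
  then obtain u v where uv: "B = {u, v}" "u \<noteq> v"
    by (auto simp: card_2_iff)
  have "u \<noteq> 0"
    using B(2) uv vec.dependent_zero[of B] by auto
  moreover have "v \<notin> vec.span {u}"
    using B(2) uv vec.independent_insert[of v "{u}"] by (simp add: insert_commute)
  ultimately have "wedge u v \<noteq> 0"
    using wedge_eq_0_imp_proportional by (metis rangeI vec.span_singleton)
  moreover have "vec.span B = L"
    using B(1,3) L(1) vec.span_minimal by blast
  ultimately show ?thesis using uv(1) by blast
qed

lemma pluecker_span: "pluecker (vec.span {u, v}) = vec.span {wedge u v}"
  unfolding pluecker_def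
proof (rule vec.span_eq[THEN iffD2], intro conjI)
  show "{wedge a b |a b. a \<in> vec.span {u, v} \<and> b \<in> vec.span {u, v}} \<subseteq> vec.span {wedge u v}"
    by (auto simp: vec_span_pair wedge_linear_combination vec.span_singleton
        simp del: vector_sub_rdistrib)
  show "{wedge u v} \<subseteq> vec.span {wedge a b |a b. a \<in> vec.span {u, v} \<and> b \<in> vec.span {u, v}}"
    by (auto intro!: vec.span_base intro: exI[of _ u] exI[of _ v])
qed

text \<open>That incident points lie on \<open>L\<close> goes through contractions: an incident
  point is a contraction of \<open>wedge u v\<close>, hence a combination of \<open>u\<close> and
  \<open>v\<close>.\<close>

lemma Gr_eq_incidence:
  assumes "L \<in> Gr" "p \<in> pluecker L" "p \<noteq> 0"
  shows "quadric p = 0" "L = {x. incidence p x = 0}" "pluecker L = vec.span {p}"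
proof -
  obtain u v where uv: "wedge u v \<noteq> 0" "L = vec.span {u, v}"
    using Gr_ex_span[OF assms(1)] by blast
  obtain c where c: "p = c *s wedge u v"
    using assms(2) unfolding uv(2) pluecker_span by (auto simp: vec.span_singleton)
  then have "c \<noteq> 0" using assms(3) by auto
  show "quadric p = 0" unfolding c by (simp add: quadric_scale quadric_wedge)
  have inc: "incidence p x = 0 \<longleftrightarrow> incidence (wedge u v) x = 0" for x
    unfolding c incidence_scale using \<open>c \<noteq> 0\<close> by simp
  have "x \<in> L \<longleftrightarrow> incidence p x = 0" for x
  proof
    assume "x \<in> L"
    then show "incidence p x = 0"
      unfolding inc uv(2) vec_span_pair by (auto simp: incidence_wedge_combination)
  next
    assume "incidence p x = 0"
    then obtain a where "x = contraction (wedge u v) a"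
      using ex_contraction[OF uv(1)] inc by blast
    then show "x \<in> L"
      unfolding uv(2) contraction_wedge
      by (simp add: vec.span_diff vec.span_scale vec.span_base)
  qed
  then show "L = {x. incidence p x = 0}" by blast
  have "wedge u v = (1 / c) *s p" using c \<open>c \<noteq> 0\<close> by simp
  then have "vec.span {wedge u v} = vec.span {p}"
    by (intro vec.span_eq[THEN iffD2]) (metis c insert_subset empty_subsetI singletonI vec.span_base vec.span_scale)
  then show "pluecker L = vec.span {p}" unfolding uv(2) pluecker_span .
qed

lemma Gr_ex_pluecker: "L \<in> Gr \<Longrightarrow> \<exists>p. p \<noteq> 0 \<and> p \<in> pluecker L"
  using Gr_ex_span pluecker_span vec.span_base by (metis singletonI)

lemma quadric_ex_Gr:
  assumes "p \<noteq> 0" "quadric p = 0"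
  shows "\<exists>L\<in>Gr. p \<in> pluecker L"
proof -
  obtain u v where p: "p = wedge u v" using ex_wedge[OF assms] by blast
  have "vec.span {u, v} \<in> Gr"
    using assms(1) vec_dim_pair unfolding p by (simp add: Gr_def)
  moreover have "p \<in> pluecker (vec.span {u, v})"
    unfolding pluecker_span p by (simp add: vec.span_base)
  ultimately show ?thesis ..
qed

text \<open>This parametrises the points of a line polynomially in its Pluecker vector and a
  covector, so that points can move along with their line.\<close>

lemma Gr_contraction:
  assumes "L \<in> Gr" "p \<in> pluecker L" "p \<noteq> 0"
  shows "L = range (contraction p)"
proof -
  have "contraction p a \<in> L" for a
    unfolding Gr_eq_incidence(2)[OF assms]
    using Gr_eq_incidence(1)[OF assms] unfolding quadric_def
    by (simp add: vec_eq_iff forall_4; algebra)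
  then show ?thesis
    using ex_contraction[OF assms(3)] Gr_eq_incidence(2)[OF assms] by blast
qed

section \<open>Zariski closed sets of lines\<close>

lemma projective_space_ex_nonzero:
  fixes x :: "(complex^'k) set"
  assumes "x \<in> projective_space"
  shows "\<exists>v\<in>x. v \<noteq> 0"
proof (rule ccontr)
  assume "\<not> ?thesis"
  then have "x \<subseteq> {0}" by blast
  then have "vec.dim x = 0" using vec.dim_eq_0 by blast
  moreover have "vec.dim x = 1" using assms by (simp add: projective_space_def)
  ultimately show False by (metis zero_neq_one)
qed

lemma projective_space_eq_span:
  fixes x :: "(complex^'k) set"
  assumes "x \<in> projective_space" "v \<in> x" "v \<noteq> 0"
  shows "x = vec.span {v}"
proof
  show "x \<subseteq> vec.span {v}"
    using projective_space_proportional[OF assms] by (auto simp: vec.span_singleton)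
  show "vec.span {v} \<subseteq> x"
    using assms by (intro vec.span_minimal) (auto simp: projective_space_def)
qed

lemma span_in_projective_space:
  fixes v :: "complex^'k"
  assumes "v \<noteq> 0"
  shows "vec.span {v} \<in> projective_space"
  using assms vec.dim_eq_card_independent[of "{v}"]
  by (simp add: projective_space_def vec.dim_span)

lemma multi_projective_space_ex_nonzero:
  fixes X :: "'n \<Rightarrow> (complex^'k) set"
  assumes "X \<in> multi_projective_space"
  shows "\<exists>v. \<forall>i. v i \<in> X i \<and> v i \<noteq> 0"
proof -
  have "\<forall>i. \<exists>v. v \<in> X i \<and> v \<noteq> 0"
    using assms projective_space_ex_nonzero by (fastforce simp: multi_projective_space_def)
  then show ?thesis by metis
qed

lemma vanishes_at_iff:
  assumes "X \<in> multi_projective_space" "multihomogeneous p" "\<And>i. v i \<in> X i \<and> v i \<noteq> 0"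
  shows "vanishes_at p X \<longleftrightarrow> p v = 0"
proof
  assume "vanishes_at p X"
  then show "p v = 0" using assms(3) by (simp add: vanishes_at_def)
next
  assume 0: "p v = 0"
  show "vanishes_at p X"
    unfolding vanishes_at_def
  proof (intro allI impI)
    fix w assume w: "\<forall>i. w i \<in> X i \<and> w i \<noteq> 0"
    have "\<exists>c. w i = c *s v i" for i
      using assms(1,3) w
      by (intro projective_space_proportional[of "X i"]) (auto simp: multi_projective_space_def)
    then obtain c where "\<And>i. w i = c i *s v i" by metis
    then have "w = (\<lambda>i. c i *s v i)" by auto
    then show "p w = 0" using assms(2) 0 unfolding multihomogeneous_def by auto
  qed
qed

lemma multihomogeneous_const: "multihomogeneous (\<lambda>v. c)"
  unfolding multihomogeneous_def by (intro exI[of _ "\<lambda>_. 0"]) simp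

lemma topspace_zariski_topology: "topspace zariski_topology = (multi_projective_space :: ('n::finite \<Rightarrow> (complex^'k) set) set)"
proof -
  have "zero_locus {\<lambda>v. 1 :: complex} = ({} :: ('n \<Rightarrow> (complex^'k) set) set)"
    using multi_projective_space_ex_nonzero by (fastforce simp: zero_locus_def vanishes_at_def)
  then have "zariski_open (multi_projective_space :: ('n \<Rightarrow> (complex^'k) set) set)"
    unfolding zariski_open_def
    by (intro exI[of _ "{\<lambda>v. 1}"]) (auto intro: polynomial_fun.const multihomogeneous_const)
  then show ?thesis
    unfolding topspace_def openin_zariski_topology by (auto simp: zariski_open_def)
qed

lemma closedin_zariski_pullback:
  assumes "f ` A \<subseteq> multi_projective_space"
  shows "closedin (pullback_topology A f zariski_topology) Z \<longleftrightarrow>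
    (\<exists>P. (\<forall>p\<in>P. polynomial_fun p \<and> multihomogeneous p) \<and> Z = {x\<in>A. \<forall>p\<in>P. vanishes_at p (f x)})"
proof -
  have top: "topspace (pullback_topology A f zariski_topology) = A"
    using assms by (auto simp: topspace_pullback_topology topspace_zariski_topology)
  have *: "f -` (multi_projective_space - zero_locus P) \<inter> A = A - {x\<in>A. \<forall>p\<in>P. vanishes_at p (f x)}" for P
    using assms by (auto simp: zero_locus_def)
  have "A - Z = A - W \<and> Z \<subseteq> A \<longleftrightarrow> Z = W" if "W \<subseteq> A" for W
    using that by blast
  from this[of "{x\<in>A. \<forall>p\<in>P. vanishes_at p (f x)}" for P]
  have "A - Z = f -` (multi_projective_space - zero_locus P) \<inter> A \<and> Z \<subseteq> A \<longleftrightarrow>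
      Z = {x\<in>A. \<forall>p\<in>P. vanishes_at p (f x)}" for P
    unfolding * by simp
  moreover have "closedin (pullback_topology A f zariski_topology) Z \<longleftrightarrow> 
    (\<exists>P. (\<forall>p\<in>P. polynomial_fun p \<and> multihomogeneous p) \<and>
      A - Z = f -` (multi_projective_space - zero_locus P) \<inter> A \<and> Z \<subseteq> A)"
    unfolding closedin_def top openin_pullback_topology openin_zariski_topology zariski_open_def
    by blast
  ultimately show ?thesis by simp
qed

lemma Gr_pluecker_multi_projective:
  assumes "\<And>i. L i \<in> Gr"
  shows "(\<lambda>i. pluecker (L i)) \<in> multi_projective_space"
  using assms pluecker_in_projective_space by (auto simp: multi_projective_space_def)

lemma closedin_Gr_topology:
  "closedin Gr_topology Z \<longleftrightarrow>
    (\<exists>P. (\<forall>p\<in>P. polynomial_fun p \<and> multihomogeneous p) \<and>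
      Z = {L\<in>Gr. \<forall>p\<in>P. vanishes_at p (\<lambda>_::unit. pluecker L)})"
  unfolding Gr_topology_def
  by (rule closedin_zariski_pullback) (auto intro: Gr_pluecker_multi_projective)

lemma closedin_Gr_power_topology:
  "closedin Gr_power_topology Z \<longleftrightarrow>
    (\<exists>P. (\<forall>p\<in>P. polynomial_fun p \<and> multihomogeneous p) \<and>
      Z = {L\<in>(\<Pi> i\<in>UNIV. Gr). \<forall>p\<in>P. vanishes_at p (\<lambda>i. pluecker (L i))})"
  unfolding Gr_power_topology_def
  by (rule closedin_zariski_pullback) (auto intro!: Gr_pluecker_multi_projective)

lemma topspace_Gr_topology: "topspace Gr_topology = Gr"
  unfolding Gr_topology_def
  by (auto simp: topspace_pullback_topology topspace_zariski_topology
      intro: Gr_pluecker_multi_projective)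

lemma topspace_Gr_power_topology: "topspace Gr_power_topology = (\<Pi> i\<in>UNIV. Gr)"
  unfolding Gr_power_topology_def
  by (auto simp: topspace_pullback_topology topspace_zariski_topology
      intro!: Gr_pluecker_multi_projective)

section \<open>Homogeneous components and irreducibility\<close>

lemma homogeneous_expansion:
  assumes "polynomial_fun f"
  shows "\<exists>H. (\<forall>d. polynomial_fun (\<lambda>v. coeff (H v) d)) \<and> (\<forall>v r. f (\<lambda>i. r *s v i) = poly (H v) r)"
  using assms
proof induction
  case (const c)
  show ?case
    by (intro exI[of _ "\<lambda>_. [:c:]"]) (auto intro: polynomial_fun.const)
next
  case (coord i j)
  have "polynomial_fun (\<lambda>v. coeff [:0, v i $ j:] d)" for d
    by (cases d; cases "d - 1") (auto simp: coeff_pCons split: nat.split intro: polynomial_fun.intros)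
  then show ?case
    by (intro exI[of _ "\<lambda>v. [:0, v i $ j:]"]) auto
next
  case (add p q)
  then obtain H K where
    "\<And>d. polynomial_fun (\<lambda>v. coeff (H v) d)" "\<And>v r. p (\<lambda>i. r *s v i) = poly (H v) r"
    "\<And>d. polynomial_fun (\<lambda>v. coeff (K v) d)" "\<And>v r. q (\<lambda>i. r *s v i) = poly (K v) r"
    by blast
  then show ?case
    by (intro exI[of _ "\<lambda>v. H v + K v"]) (auto intro: polynomial_fun.add)
next
  case (mult p q)
  then obtain H K where
    "\<And>d. polynomial_fun (\<lambda>v. coeff (H v) d)" "\<And>v r. p (\<lambda>i. r *s v i) = poly (H v) r"
    "\<And>d. polynomial_fun (\<lambda>v. coeff (K v) d)" "\<And>v r. q (\<lambda>i. r *s v i) = poly (K v) r"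
    by blast
  then show ?case
    by (intro exI[of _ "\<lambda>v. H v * K v"])
      (auto simp: coeff_mult intro!: polynomial_fun_sum polynomial_fun.mult)
qed

text \<open>Some homogeneous component \<open>h\<close> of \<open>f\<close> survives at
  \<open>p\<close>. Wherever \<open>h\<close> is nonzero, \<open>f\<close> is a nonzero polynomial
  in the scaling factor, hence nonzero at all but finitely many multiples of the vector.\<close>

lemma ex_homogeneous_component:
  fixes f :: "(unit \<Rightarrow> complex^'k) \<Rightarrow> complex"
  assumes "polynomial_fun f" "f (\<lambda>_. p) \<noteq> 0"
  shows "\<exists>h :: (unit \<Rightarrow> complex^'k) \<Rightarrow> complex. polynomial_fun h \<and> multihomogeneous h \<and> h (\<lambda>_. p) \<noteq> 0 \<and>
    (\<forall>q. h (\<lambda>_. q) \<noteq> 0 \<longrightarrow> (\<exists>H. H \<noteq> 0 \<and> (\<forall>r. f (\<lambda>_. r *s q) = poly H r)))"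
proof -
  obtain H where H: "\<And>d. polynomial_fun (\<lambda>v. coeff (H v) d)"
    "\<And>v r. f (\<lambda>i. r *s v i) = poly (H v) r"
    using homogeneous_expansion[OF assms(1)] by blast
  have "H (\<lambda>_. p) \<noteq> 0" using H(2)[of 1 "\<lambda>_. p"] assms(2) by auto
  then obtain d where d: "coeff (H (\<lambda>_. p)) d \<noteq> 0" by (auto simp: poly_eq_iff)
  have "coeff (H (\<lambda>i. c i *s v i)) d = c () ^ d * coeff (H v) d" for c v
  proof -
    \<comment> \<open>Scaling the argument of \<open>f\<close> by \<open>c ()\<close> amounts to
      substituting \<open>c () * r\<close> for \<open>r\<close>; comparing coefficients gives the
      degree.\<close>
    have "poly (H (\<lambda>i. c i *s v i)) r = poly (pcompose (H v) [:0, c ():]) r" for r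
    proof -
      have "poly (H (\<lambda>i. c i *s v i)) r = f (\<lambda>i. r *s (c i *s v i))" by (simp only: H(2))
      also have "(\<lambda>i. r *s (c i *s v i)) = (\<lambda>i. (r * c ()) *s v i)" by (auto simp: fun_eq_iff)
      finally show ?thesis by (simp add: H(2) poly_pcompose)
    qed
    then have "H (\<lambda>i. c i *s v i) = pcompose (H v) [:0, c ():]"
      by (simp add: poly_eq_poly_eq_iff[symmetric] fun_eq_iff)
    then show ?thesis by (simp add: coeff_pcompose_linear)
  qed
  then have mh: "multihomogeneous (\<lambda>v. coeff (H v) d)"
    unfolding multihomogeneous_def by (intro exI[of _ "\<lambda>_. d"]) (simp add: UNIV_unit)
  have ex: "\<exists>H. H \<noteq> 0 \<and> (\<forall>r. f (\<lambda>_. r *s q) = poly H r)" if "coeff (H (\<lambda>_. q)) d \<noteq> 0" for q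
    using that H(2)[of _ "\<lambda>_. q"] by (intro exI[of _ "H (\<lambda>_. q)"]) auto
  show ?thesis
    by (intro exI[of _ "\<lambda>v. coeff (H v) d"] conjI allI impI H(1) mh d ex)
qed

text \<open>Irreducibility of \<open>C\<close> carried over to inhomogeneous polynomials on its
  cone. It applies directly to homogeneous components of \<open>f\<close> and \<open>g\<close>, and
  afterwards a common representative is found by scaling.\<close>

lemma irreducible_ex_nonzero_both:
  fixes f g :: "(unit \<Rightarrow> complex^6) \<Rightarrow> complex"
  assumes "irreducible_in Gr_topology C" "polynomial_fun f" "polynomial_fun g"
    and f: "L \<in> C" "p \<in> pluecker L" "p \<noteq> 0" "f (\<lambda>_. p) \<noteq> 0"
    and g: "K \<in> C" "q \<in> pluecker K" "q \<noteq> 0" "g (\<lambda>_. q) \<noteq> 0"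
  shows "\<exists>M\<in>C. \<exists>r. r \<in> pluecker M \<and> r \<noteq> 0 \<and> f (\<lambda>_. r) \<noteq> 0 \<and> g (\<lambda>_. r) \<noteq> 0"
proof -
  have C: "C \<subseteq> Gr"
    using assms(1) by (simp add: irreducible_in_def topspace_Gr_topology)
  obtain f' :: "(unit \<Rightarrow> complex^6) \<Rightarrow> complex" where f': "polynomial_fun f'" "multihomogeneous f'" "f' (\<lambda>_. p) \<noteq> 0"
    "\<And>q. f' (\<lambda>_. q) \<noteq> 0 \<Longrightarrow> \<exists>H. H \<noteq> 0 \<and> (\<forall>r. f (\<lambda>_. r *s q) = poly H r)"
    using ex_homogeneous_component[OF assms(2) f(4)] by blast
  obtain g' :: "(unit \<Rightarrow> complex^6) \<Rightarrow> complex" where g': "polynomial_fun g'" "multihomogeneous g'" "g' (\<lambda>_. q) \<noteq> 0"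
    "\<And>q. g' (\<lambda>_. q) \<noteq> 0 \<Longrightarrow> \<exists>H. H \<noteq> 0 \<and> (\<forall>r. g (\<lambda>_. r *s q) = poly H r)"
    using ex_homogeneous_component[OF assms(3) g(4)] by blast
  define A where "A h = {L\<in>Gr. \<forall>p\<in>{h}. vanishes_at p (\<lambda>_::unit. pluecker L)}" for h
  have "closedin Gr_topology (A h)" if "polynomial_fun h" "multihomogeneous h" for h
    unfolding closedin_Gr_topology A_def using that by (intro exI[of _ "{h}"]) auto
  then have "closedin Gr_topology (A f')" "closedin Gr_topology (A g')"
    using f' g' by auto
  moreover have A: "M \<in> A h \<longleftrightarrow> h (\<lambda>_. r) = 0"
    if "M \<in> Gr" "multihomogeneous h" "r \<in> pluecker M" "r \<noteq> 0" for M h r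
    using vanishes_at_iff[OF Gr_pluecker_multi_projective that(2), of "\<lambda>_. M" "\<lambda>_. r"] that
    by (simp add: A_def)
  have "L \<notin> A f'" "K \<notin> A g'"
    using A[of L f' p] A[of K g' q] f(1-3) g(1-3) f'(2,3) g'(2,3) C by blast+
  then have "\<not> C \<subseteq> A f'" "\<not> C \<subseteq> A g'"
    using f(1) g(1) by blast+
  ultimately obtain M where M: "M \<in> C" "M \<notin> A f'" "M \<notin> A g'"
    using assms(1) unfolding irreducible_in_def by blast
  obtain r where r: "r \<noteq> 0" "r \<in> pluecker M" using Gr_ex_pluecker C M(1) by blast
  have "f' (\<lambda>_. r) \<noteq> 0" "g' (\<lambda>_. r) \<noteq> 0"
    using M A r C f'(2) g'(2) by blast+
  then obtain F G where FG: "F \<noteq> 0" "\<forall>s. f (\<lambda>_. s *s r) = poly F s"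
    "G \<noteq> 0" "\<forall>s. g (\<lambda>_. s *s r) = poly G s"
    using f'(4)[of r] g'(4)[of r] by blast
  \<comment> \<open>The components only guarantee that \<open>f\<close> and \<open>g\<close> are
    nonzero at most multiples of \<open>r\<close>; one nonzero multiple has to serve both.\<close>
  obtain s where s: "s \<notin> {0}" "poly F s \<noteq> 0" "poly G s \<noteq> 0"
    using poly_ex_nonzero_both[of F G "{0}"] FG by blast
  have "s *s r \<in> pluecker M"
    using r(2) unfolding pluecker_def by (rule vec.span_scale)
  then show ?thesis
    using M(1) s FG r(1) by (intro bexI[of _ M] exI[of _ "s *s r"]) auto
qed

section \<open>General points and focal points\<close>

lemma nonempty_open_contains_polynomial_nonzeros:
  assumes "openin projective_topology U" "U \<noteq> {}"
  shows "\<exists>g :: (unit \<Rightarrow> complex^'k) \<Rightarrow> complex. polynomial_fun g \<and> (\<exists>v. g v \<noteq> 0) \<and>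
    (\<forall>v. g v \<noteq> 0 \<longrightarrow> v () \<noteq> 0 \<and> vec.span {v ()} \<in> U)"
proof -
  obtain P :: "((unit \<Rightarrow> complex^'k) \<Rightarrow> complex) set" where
    P: "\<forall>p\<in>P. polynomial_fun p \<and> multihomogeneous p"
    "U = (\<lambda>x _. x) -` (multi_projective_space - zero_locus P) \<inter> projective_space"
    using assms(1)
    unfolding projective_topology_def openin_pullback_topology openin_zariski_topology zariski_open_def
    by blast
  obtain x where "x \<in> U" using assms(2) by blast
  then obtain p v where p: "p \<in> P" "\<forall>i. v i \<in> x \<and> v i \<noteq> 0" "p v \<noteq> 0"
    unfolding P(2) zero_locus_def vanishes_at_def by auto
  \<comment> \<open>Multiplying by a coordinate excludes the zero vector, where \<open>p\<close>
    itself could be a nonzero constant.\<close>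
  obtain k where k: "v () $ k \<noteq> 0" using p(2) by (auto simp: vec_eq_iff)
  have "w () \<noteq> 0 \<and> vec.span {w ()} \<in> U" if "p w * w () $ k \<noteq> 0" for w
  proof -
    have w: "w () \<noteq> 0" "p w \<noteq> 0" using that by auto
    have proj: "(\<lambda>_. vec.span {w ()}) \<in> multi_projective_space"
      using span_in_projective_space[OF w(1)] by (simp add: multi_projective_space_def)
    have "\<not> vanishes_at p (\<lambda>_. vec.span {w ()})"
      using vanishes_at_iff[OF proj, of p w] P(1) p(1) w by (auto simp: vec.span_base)
    then show ?thesis
      using proj p(1) w span_in_projective_space[OF w(1)] unfolding P(2) zero_locus_def by auto
  qed
  then show ?thesis
    using P(1) p(1,3) k
    by (intro exI[of _ "\<lambda>v. p v * v () $ k"]) (auto intro!: polynomial_fun.intros)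
qed

text \<open>Two nonempty open sets of points meet, because two nonzero polynomials are nonzero at a
  common vector.\<close>

lemma has_order_unique:
  assumes "has_order C a" "has_order C b"
  shows "a = b"
proof -
  obtain U V where U: "openin projective_topology U" "U \<noteq> {}" "\<And>x. x \<in> U \<Longrightarrow> card (lines_through C x) = a"
    and V: "openin projective_topology V" "V \<noteq> {}" "\<And>x. x \<in> V \<Longrightarrow> card (lines_through C x) = b"
    using assms unfolding has_order_def for_general_point_def by blast
  obtain g h v w where "polynomial_fun (g :: (unit \<Rightarrow> _) \<Rightarrow> _)" "polynomial_fun h" "g v \<noteq> 0" "h w \<noteq> 0"
    and gh: "\<And>v. g v \<noteq> 0 \<Longrightarrow> vec.span {v ()} \<in> U" "\<And>v. h v \<noteq> 0 \<Longrightarrow> vec.span {v ()} \<in> V"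
    using nonempty_open_contains_polynomial_nonzeros[OF U(1,2)]
      nonempty_open_contains_polynomial_nonzeros[OF V(1,2)] by blast
  then obtain u where "g u \<noteq> 0" "h u \<noteq> 0" using polynomial_fun_ex_nonzero_both by blast
  then show ?thesis using gh U(3) V(3) by metis
qed

lemma not_focal_iff:
  assumes "has_order C 1" "x \<in> projective_space"
  shows "x \<notin> focal_locus C \<longleftrightarrow> (\<exists>L. lines_through C x = {L})"
proof -
  have "x \<notin> focal_locus C \<longleftrightarrow> finite (lines_through C x) \<and> card (lines_through C x) = 1"
    unfolding focal_locus_def using assms has_order_unique[OF _ assms(1)] by blast
  then show ?thesis using card_1_singleton_iff[of "lines_through C x"] by auto
qed

lemma rational_camera_eq:
  "lines_through C x = {L} \<Longrightarrow> rational_camera C x = L"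
  unfolding rational_camera_def lines_through_def by (intro the_equality) blast+

section \<open>Closed sets in powers of the Grassmannian\<close>

lemma polynomial_fun_incidence:
  assumes "\<And>k. polynomial_fun (\<lambda>v. \<phi> v $ k)" "\<And>k. polynomial_fun (\<lambda>v. \<psi> v $ k)"
  shows "polynomial_fun (\<lambda>v. incidence (\<phi> v) (\<psi> v) $ e)"
proof -
  have "\<forall>e. polynomial_fun (\<lambda>v. incidence (\<phi> v) (\<psi> v) $ e)"
    unfolding forall_4 using assms by (simp add: polynomial_fun_intros)
  then show ?thesis ..
qed

lemma polynomial_fun_contraction:
  assumes "\<And>k. polynomial_fun (\<lambda>v. \<phi> v $ k)" "\<And>k. polynomial_fun (\<lambda>v. \<psi> v $ k)"
  shows "polynomial_fun (\<lambda>v. contraction (\<phi> v) (\<psi> v) $ e)"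
proof -
  have "\<forall>e. polynomial_fun (\<lambda>v. contraction (\<phi> v) (\<psi> v) $ e)"
    unfolding forall_4 using assms by (simp add: polynomial_fun_intros)
  then show ?thesis ..
qed

lemma polynomial_fun_quadric:
  assumes "\<And>k. polynomial_fun (\<lambda>v. \<phi> v $ k)"
  shows "polynomial_fun (\<lambda>v. quadric (\<phi> v))"
  unfolding quadric_def using assms by (simp add: polynomial_fun_intros)

lemma concurrent_iff_incidence:
  assumes "\<And>i. L i \<in> Gr" "\<And>i. p i \<in> pluecker (L i) \<and> p i \<noteq> 0"
  shows "L \<in> concurrent_lines_variety \<longleftrightarrow> (\<exists>x. x \<noteq> 0 \<and> (\<forall>i. incidence (p i) x = 0))"
proof
  assume "L \<in> concurrent_lines_variety"
  then obtain x where x: "x \<in> projective_space" "\<And>i. x \<subseteq> L i"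
    by (auto simp: concurrent_lines_variety_def)
  obtain v where "v \<in> x" "v \<noteq> 0" using projective_space_ex_nonzero[OF x(1)] by blast
  moreover have "incidence (p i) v = 0" for i
    using Gr_eq_incidence(2)[of "L i" "p i"] assms x(2)[of i] \<open>v \<in> x\<close> by blast
  ultimately show "\<exists>x. x \<noteq> 0 \<and> (\<forall>i. incidence (p i) x = 0)" by blast
next
  assume "\<exists>x. x \<noteq> 0 \<and> (\<forall>i. incidence (p i) x = 0)"
  then obtain x where x: "x \<noteq> 0" "\<And>i. incidence (p i) x = 0" by blast
  have "x \<in> L i" for i
    using Gr_eq_incidence(2)[of "L i" "p i"] assms x(2)[of i] by blast
  then have "vec.span {x} \<subseteq> L i" for i
    using assms(1)[of i] by (intro vec.span_minimal) (auto simp: Gr_def)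
  then show "L \<in> concurrent_lines_variety"
    unfolding concurrent_lines_variety_def using span_in_projective_space[OF x(1)] assms(1) by blast
qed

text \<open>A common point is a nonzero solution of a linear system whose coefficients are Pluecker
  coordinates. For lines without one, the product of the pivots of
  \<open>linear_system_elimination\<close> is the separating polynomial.\<close>

lemma closedin_concurrent_lines_variety:
  "closedin Gr_power_topology (concurrent_lines_variety :: ('n::finite \<Rightarrow> (complex^4) set) set)"
proof -
  define hom where "hom d m \<longleftrightarrow> (\<forall>c v. m (\<lambda>i. c i *s v i) = (\<Prod>i\<in>UNIV. c i ^ d i) * m v)"
    for d :: "'n \<Rightarrow> nat" and m :: "('n \<Rightarrow> complex^6) \<Rightarrow> complex"
  \<comment> \<open>All entries of a row share one multidegree, so cross-multiplying two rows keeps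
    the entries multihomogeneous.\<close>
  define G where "G v \<longleftrightarrow> (\<exists>d. \<forall>k. polynomial_fun (v k) \<and> hom d (v k))"
    for v :: "nat \<Rightarrow> ('n \<Rightarrow> complex^6) \<Rightarrow> complex"
  have hom_mult: "hom (\<lambda>i. d i + e i) (\<lambda>y. m y * n y)" if "hom d m" "hom e n" for d e m n
    using that unfolding hom_def by (simp add: power_add prod.distrib)
  have hom_diff: "hom d (\<lambda>y. m y - n y)" if "hom d m" "hom d n" for d m n
    using that unfolding hom_def by (simp add: algebra_simps)
  \<comment> \<open>The elimination numbers columns by naturals below 4; \<open>h\<close> translates
    them into coordinates.\<close>
  obtain h :: "nat \<Rightarrow> 4" where h: "bij_betw h {..<4} UNIV"
    using ex_bij_betw_nat_finite[of "UNIV :: 4 set"] by (auto simp: atLeast0LessThan)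
  define row where "row i e k = (\<lambda>y :: 'n \<Rightarrow> complex^6. incidence (y i) (axis (h k) 1) $ e)" for i e k
  define V where "V = {row i e | i e. True}"
  have row_sum: "(\<Sum>k<4. row i e k y * z (h k)) = incidence (y i) (\<chi> j. z j) $ e" for i e y z
  proof -
    have "(\<Sum>k<4. row i e k y * z (h k)) = (\<Sum>j\<in>UNIV. incidence (y i) (axis j 1) $ e * z j)"
      unfolding row_def by (rule sum.reindex_bij_betw[OF h])
    also have "\<dots> = incidence (y i) (\<chi> j. z j) $ e"
    proof -
      have "\<forall>e. (\<Sum>j\<in>UNIV. incidence (y i) (axis j 1) $ e * z j) = incidence (y i) (\<chi> j. z j) $ e"
        unfolding forall_4 by (simp add: sum_4 axis_def algebra_simps)
      then show ?thesis ..
    qed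
    finally show ?thesis .
  qed
  have V: "(\<forall>v\<in>V. (\<Sum>k<4. v k y * z (h k)) = 0) \<longleftrightarrow> (\<forall>i. incidence (y i) (\<chi> j. z j) = 0)" for y z
  proof -
    have "(\<forall>v\<in>V. (\<Sum>k<4. v k y * z (h k)) = 0) \<longleftrightarrow> (\<forall>i e. (\<Sum>k<4. row i e k y * z (h k)) = 0)"
      unfolding V_def by blast
    then show ?thesis unfolding row_sum by (simp add: vec_eq_iff)
  qed
  have V_G: "\<forall>v\<in>V. G v"
  proof
    fix v assume "v \<in> V"
    then obtain i e where v: "v = row i e" by (auto simp: V_def)
    have "polynomial_fun (row i e k)" for k
      unfolding row_def by (intro polynomial_fun_incidence polynomial_fun.intros)
    moreover have "hom (\<lambda>j. if j = i then 1 else 0) (row i e k)" for k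
      unfolding hom_def row_def
      by (simp add: incidence_scale if_distrib[of "\<lambda>n. _ ^ n"] cong: if_cong)
    ultimately show "G v" unfolding G_def v by blast
  qed
  have sep: "\<exists>m. polynomial_fun m \<and> multihomogeneous m \<and> \<not> vanishes_at m (\<lambda>i. pluecker (L i)) \<and>
      (\<forall>K\<in>concurrent_lines_variety. vanishes_at m (\<lambda>i. pluecker (K i)))"
    if L: "\<And>i. L i \<in> Gr" "L \<notin> concurrent_lines_variety" for L :: "'n \<Rightarrow> (complex^4) set"
  proof -
    obtain p where p: "\<And>i. p i \<in> pluecker (L i) \<and> p i \<noteq> 0"
      using multi_projective_space_ex_nonzero[OF Gr_pluecker_multi_projective] L(1) by blast
    have "\<exists>m. (polynomial_fun m \<and> multihomogeneous m) \<and> m p \<noteq> 0 \<and>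
      (\<forall>y z. m y \<noteq> 0 \<longrightarrow> (\<forall>v\<in>V. (\<Sum>k<4. v k y * z k) = 0) \<longrightarrow> (\<forall>k<4. z k = 0))"
    proof (rule linear_system_elimination[where G = G])
      show "G (\<lambda>k y. v l y * w k y - w l y * v k y)" if gv: "G v" "G w" for v w l
      proof -
        obtain d e where de: "\<And>k. polynomial_fun (v k) \<and> hom d (v k)"
          "\<And>k. polynomial_fun (w k) \<and> hom e (w k)"
          using gv unfolding G_def by blast
        have "hom (\<lambda>i. d i + e i) (\<lambda>y. v l y * w k y - w l y * v k y)" for k
          using hom_mult[of d "v l" e "w k"] hom_mult[of d "v k" e "w l"] de
          by (intro hom_diff) (auto simp: mult.commute)
        then show ?thesis
          unfolding G_def using de
          by (intro exI[of _ "\<lambda>i. d i + e i"] allI conjI polynomial_fun_diff polynomial_fun.mult) auto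
      qed
      show "polynomial_fun (v k) \<and> multihomogeneous (v k)" if "G v" for v k
        using that unfolding G_def multihomogeneous_def hom_def by blast
      show "polynomial_fun (\<lambda>y. 1) \<and> multihomogeneous (\<lambda>y. 1)"
        by (simp add: polynomial_fun.const multihomogeneous_const)
      show "polynomial_fun (\<lambda>y. p y * q y) \<and> multihomogeneous (\<lambda>y. p y * q y)"
        if "polynomial_fun p \<and> multihomogeneous p" "polynomial_fun q \<and> multihomogeneous q" for p q
        using that by (simp add: polynomial_fun.mult multihomogeneous_mult)
      show "\<forall>v\<in>V. G v" by (rule V_G)
      fix z assume z: "\<forall>v\<in>V. (\<Sum>k<4. v k p * z k) = 0"
      define z' where "z' j = z (inv_into {..<4} h j)" for j
      have z': "z' (h k) = z k" if "k < 4" for k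
        using that h by (simp add: z'_def bij_betw_def inv_into_f_f)
      have "\<forall>v\<in>V. (\<Sum>k<4. v k p * z' (h k)) = 0"
        using z by (simp add: z' cong: sum.cong_simp)
      then have "(\<chi> j. z' j) = 0"
        using V concurrent_iff_incidence[of L p, OF L(1) p] L(2) by blast
      then show "\<forall>k<4. z k = 0"
        using z' by (auto simp: vec_eq_iff)
    qed
    then obtain m where m: "polynomial_fun m" "multihomogeneous m" "m p \<noteq> 0"
      "\<And>y z. m y \<noteq> 0 \<Longrightarrow> (\<forall>v\<in>V. (\<Sum>k<4. v k y * z k) = 0) \<Longrightarrow> (\<forall>k<4. z k = 0)"
      by blast
    have "vanishes_at m (\<lambda>i. pluecker (K i))" if K: "K \<in> concurrent_lines_variety" for K
    proof -
      have KGr: "K i \<in> Gr" for i using K by (auto simp: concurrent_lines_variety_def)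
      obtain q where q: "\<And>i. q i \<in> pluecker (K i) \<and> q i \<noteq> 0"
        using multi_projective_space_ex_nonzero[OF Gr_pluecker_multi_projective] KGr by blast
      obtain x where x: "x \<noteq> 0" "\<And>i. incidence (q i) x = 0"
        using K concurrent_iff_incidence[of K q, OF KGr q] by blast
      have "\<forall>v\<in>V. (\<Sum>k<4. v k q * x $ h k) = 0"
        using V[of q "\<lambda>j. x $ j"] x(2) by simp
      moreover have "\<not> (\<forall>k<4. x $ h k = 0)"
      proof
        assume 0: "\<forall>k<4. x $ h k = 0"
        have "x $ j = 0" for j
          using 0 h by (metis UNIV_I bij_betw_def imageE lessThan_iff)
        then show False using x(1) by (simp add: vec_eq_iff)
      qed
      ultimately have "m q = 0" using m(4)[of q "\<lambda>k. x $ h k"] by blast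
      then show ?thesis
        using vanishes_at_iff[OF Gr_pluecker_multi_projective m(2)] KGr q by blast
    qed
    moreover have "\<not> vanishes_at m (\<lambda>i. pluecker (L i))"
      using m(3) p unfolding vanishes_at_def by blast
    ultimately show ?thesis using m(1,2) by blast
  qed
  define P where "P = {m :: ('n \<Rightarrow> complex^6) \<Rightarrow> complex. polynomial_fun m \<and> multihomogeneous m \<and>
    (\<forall>K\<in>concurrent_lines_variety. vanishes_at m (\<lambda>i. pluecker (K i)))}"
  have "concurrent_lines_variety \<subseteq> (\<Pi> i\<in>UNIV. Gr)"
    by (auto simp: concurrent_lines_variety_def)
  then have "concurrent_lines_variety \<subseteq> {L\<in>(\<Pi> i\<in>UNIV. Gr). \<forall>p\<in>P. vanishes_at p (\<lambda>i. pluecker (L i))}"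
    unfolding P_def by blast
  moreover have "L \<in> concurrent_lines_variety"
    if "L \<in> (\<Pi> i\<in>UNIV. Gr)" "\<forall>p\<in>P. vanishes_at p (\<lambda>i. pluecker (L i))" for L
    using sep[of L] that unfolding P_def by blast
  ultimately have "concurrent_lines_variety =
      {L\<in>(\<Pi> i\<in>UNIV. Gr). \<forall>p\<in>P. vanishes_at p (\<lambda>i. pluecker (L i))}"
    by blast
  then show ?thesis
    unfolding closedin_Gr_power_topology by (intro exI[of _ P]) (auto simp: P_def)
qed

lemma polynomial_fun_reindex:
  assumes "polynomial_fun p"
  shows "polynomial_fun (\<lambda>v. p (\<lambda>i. v (\<sigma> i)))"
  by (rule polynomial_fun_compose[of p "\<lambda>v i. v (\<sigma> i)", OF assms polynomial_fun.coord])

lemma closedin_Gr_power_Pi: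
  fixes C :: "'n::finite \<Rightarrow> (complex^4) set set"
  assumes "\<And>i. closedin Gr_topology (C i)"
  shows "closedin Gr_power_topology (\<Pi> i\<in>UNIV. C i)"
proof -
  have "\<forall>i. \<exists>P. (\<forall>p\<in>P. polynomial_fun p \<and> multihomogeneous p) \<and>
      C i = {L\<in>Gr. \<forall>p\<in>P. vanishes_at p (\<lambda>_::unit. pluecker L)}"
    using assms by (simp add: closedin_Gr_topology)
  from choice[OF this] obtain P where "\<forall>i. (\<forall>p\<in>P i. polynomial_fun p \<and> multihomogeneous p) \<and>
      C i = {L\<in>Gr. \<forall>p\<in>P i. vanishes_at p (\<lambda>_::unit. pluecker L)}" ..
  then have P: "\<And>i p. p \<in> P i \<Longrightarrow> polynomial_fun p \<and> multihomogeneous p"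
    "\<And>i. C i = {L\<in>Gr. \<forall>p\<in>P i. vanishes_at p (\<lambda>_::unit. pluecker L)}"
    by simp_all
  define Q where "Q = {(\<lambda>v :: 'n \<Rightarrow> complex^6. p (\<lambda>_ :: unit. v i)) | i p. p \<in> P i}"
  have mh: "multihomogeneous (\<lambda>v :: 'n \<Rightarrow> complex^6. p (\<lambda>_. v i))" if pP: "p \<in> P i" for p i
  proof -
    obtain d where d: "\<And>c v. p (\<lambda>i. c i *s v i) = (\<Prod>i\<in>UNIV. c i ^ d i) * p v"
      using P(1)[OF pP] unfolding multihomogeneous_def by blast
    have "p (\<lambda>_. c *s w) = c ^ d () * p (\<lambda>_. w)" for c w
      using d[of "\<lambda>_. c" "\<lambda>_. w"] by (simp add: UNIV_unit)
    then show ?thesis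
      unfolding multihomogeneous_def
      by (intro exI[of _ "\<lambda>j. if j = i then d () else 0"])
        (simp add: if_distrib[of "\<lambda>n. _ ^ n"] cong: if_cong)
  qed
  have Q: "\<forall>q\<in>Q. polynomial_fun q \<and> multihomogeneous q"
  proof
    fix q assume "q \<in> Q"
    then obtain i p where "q = (\<lambda>v. p (\<lambda>_. v i))" "p \<in> P i" unfolding Q_def by blast
    then show "polynomial_fun q \<and> multihomogeneous q"
      using P(1) mh polynomial_fun_reindex[of p "\<lambda>_. i"] by simp
  qed
  have van: "vanishes_at (\<lambda>v. p (\<lambda>_. v i)) (\<lambda>i. pluecker (L i)) \<longleftrightarrow> vanishes_at p (\<lambda>_. pluecker (L i))"
    if Lp: "\<And>i. L i \<in> Gr" "p \<in> P i" for L i p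
  proof -
    obtain v where v: "\<And>i. v i \<in> pluecker (L i) \<and> v i \<noteq> 0"
      using multi_projective_space_ex_nonzero[OF Gr_pluecker_multi_projective] Lp(1) by blast
    show ?thesis
      using vanishes_at_iff[OF Gr_pluecker_multi_projective mh[OF Lp(2)], of L v] v Lp(1)
        vanishes_at_iff[OF Gr_pluecker_multi_projective, of "\<lambda>_. L i" p "\<lambda>_. v i"] P(1)[OF Lp(2)]
      by simp
  qed
  have "(\<Pi> i\<in>UNIV. C i) = {L\<in>(\<Pi> i\<in>UNIV. Gr). \<forall>q\<in>Q. vanishes_at q (\<lambda>i. pluecker (L i))}"
    (is "?L = ?R")
  proof (rule set_eqI)
    fix L
    have "L \<in> ?L \<longleftrightarrow> (\<forall>i. L i \<in> Gr) \<and> (\<forall>i. \<forall>p\<in>P i. vanishes_at p (\<lambda>_. pluecker (L i)))"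
      by (auto simp: P(2))
    also have "\<dots> \<longleftrightarrow> L \<in> ?R"
    proof -
      have "(\<forall>q\<in>Q. vanishes_at q (\<lambda>i. pluecker (L i))) \<longleftrightarrow>
          (\<forall>i. \<forall>p\<in>P i. vanishes_at (\<lambda>v. p (\<lambda>_. v i)) (\<lambda>i. pluecker (L i)))"
        unfolding Q_def by blast
      moreover have "vanishes_at (\<lambda>v. p (\<lambda>_. v i)) (\<lambda>i. pluecker (L i)) \<longleftrightarrow> vanishes_at p (\<lambda>_. pluecker (L i))"
        if "\<forall>i. L i \<in> Gr" "p \<in> P i" for i p
        using van[of L p i] that by blast
      ultimately show ?thesis by (auto simp: Pi_iff)
    qed
    finally show "L \<in> ?L \<longleftrightarrow> L \<in> ?R" .
  qed
  then show ?thesis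
    unfolding closedin_Gr_power_topology using Q by blast
qed

section \<open>The multi-image variety\<close>

lemma algebraic_set_Collect_conj:
  "algebraic_set {v. P v} \<Longrightarrow> algebraic_set {v. Q v} \<Longrightarrow> algebraic_set {v. P v \<and> Q v}"
  using algebraic_set_Int[of "{v. P v}" "{v. Q v}"] by (simp add: Collect_conj_eq)

lemma algebraic_set_Collect_ball:
  assumes "\<And>x. x \<in> A \<Longrightarrow> algebraic_set {v. P x v}"
  shows "algebraic_set {v. \<forall>x\<in>A. P x v}"
proof -
  have "{v. \<forall>x\<in>A. P x v} = (\<Inter>x\<in>A. {v. P x v})" by blast
  then show ?thesis using algebraic_set_INT[of A "\<lambda>x. {v. P x v}"] assms by simp
qed

lemma algebraic_set_Collect_all:
  "(\<And>x. algebraic_set {v. P x v}) \<Longrightarrow> algebraic_set {v. \<forall>x. P x v}"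
  using algebraic_set_Collect_ball[of UNIV P] by simp

section \<open>Elimination of lines through a point\<close>

text \<open>All blocks of a configuration have the same length, so a point must travel in a block of
  length 6.\<close>

definition point_block :: "complex^4 \<Rightarrow> complex^6" where
  "point_block x = vector [x$1, x$2, x$3, x$4, 0, 0]"

definition block_point :: "complex^6 \<Rightarrow> complex^4" where
  "block_point w = vector [w$1, w$2, w$3, w$4]"

lemma block_point_nth [simp]:
  "block_point w $ 1 = w$1" "block_point w $ 2 = w$2"
  "block_point w $ 3 = w$3" "block_point w $ 4 = w$4"
  by (simp_all add: block_point_def vector_def)

lemma point_block_nth [simp]:
  "point_block x $ 1 = x$1" "point_block x $ 2 = x$2" "point_block x $ 3 = x$3"
  "point_block x $ 4 = x$4" "point_block x $ 5 = 0" "point_block x $ 6 = 0"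
  by (simp_all add: point_block_def vector_def)

lemma block_point_point_block [simp]: "block_point (point_block x) = x"
  by (simp add: vec_eq_iff forall_4)

lemma polynomial_fun_block_point:
  assumes "\<And>k. polynomial_fun (\<lambda>v. \<phi> v $ k)"
  shows "polynomial_fun (\<lambda>v. block_point (\<phi> v) $ k)"
proof -
  have "\<forall>k. polynomial_fun (\<lambda>v. block_point (\<phi> v) $ k)"
    unfolding forall_4 using assms by simp
  then show ?thesis ..
qed

lemma polynomial_fun_point_block:
  assumes "\<And>k. polynomial_fun (\<lambda>v. \<phi> v $ k)"
  shows "polynomial_fun (\<lambda>v. point_block (\<phi> v) $ k)"
proof -
  have "\<forall>k. polynomial_fun (\<lambda>v. point_block (\<phi> v) $ k)"
    unfolding forall_6 using assms by (simp add: polynomial_fun.const)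
  then show ?thesis ..
qed

lemma multihomogeneous_scale_zero:
  assumes "multihomogeneous p" "p v = 0"
  shows "p (\<lambda>i. c i *s v i) = 0"
  using assms unfolding multihomogeneous_def by auto

text \<open>The block \<open>None\<close> carries the homogeneous coordinates of a point, padded to length 6, and
  the block \<open>Some i\<close> a Pluecker vector of the \<open>i\<close>-th line.\<close>

definition point_line_config ::
    "'n \<Rightarrow> complex^4 \<Rightarrow> complex^6 \<Rightarrow> 'n option \<Rightarrow> complex^6" where
  "point_line_config j x p = (\<lambda>i. case i of None \<Rightarrow> point_block x | Some i \<Rightarrow> if i = j then p else 0)"

text \<open>In use, \<open>E i\<close> consists of equations of the \<open>i\<close>-th congruence
  and \<open>P\<close> of equations of the multi-image variety. The Pluecker relation ensures that
  nonzero blocks produced by elimination come from lines.\<close>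

definition elimination_system ::
    "('n \<Rightarrow> ((unit \<Rightarrow> complex^6) \<Rightarrow> complex) set) \<Rightarrow> (('n \<Rightarrow> complex^6) \<Rightarrow> complex) set \<Rightarrow>
     ('n option \<Rightarrow> complex^6) set" where
  "elimination_system E P =
     {v. (\<forall>i. quadric (v (Some i)) = 0) \<and>
         (\<forall>i e. incidence (v (Some i)) (block_point (v None)) $ e = 0) \<and>
         (\<forall>i. \<forall>p\<in>E i. p (\<lambda>_. v (Some i)) = 0) \<and>
         (\<forall>p\<in>P. p (\<lambda>i. v (Some i)) = 0)}"

lemma algebraic_set_elimination_system:
  fixes E :: "'n \<Rightarrow> ((unit \<Rightarrow> complex^6) \<Rightarrow> complex) set"
  assumes "\<And>i p. p \<in> E i \<Longrightarrow> polynomial_fun p" "\<And>p. p \<in> P \<Longrightarrow> polynomial_fun p"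
  shows "algebraic_set (elimination_system E P)"
  unfolding elimination_system_def
proof (intro algebraic_set_Collect_conj algebraic_set_Collect_all algebraic_set_Collect_ball
    algebraic_set_zeros)
  show "polynomial_fun (\<lambda>v :: 'n option \<Rightarrow> complex^6. quadric (v (Some i)))" for i
    by (intro polynomial_fun_quadric polynomial_fun.coord)
  show "polynomial_fun (\<lambda>v :: 'n option \<Rightarrow> complex^6.
      incidence (v (Some i)) (block_point (v None)) $ e)" for i e
    by (intro polynomial_fun_incidence polynomial_fun_block_point polynomial_fun.coord)
  show "polynomial_fun (\<lambda>v :: 'n option \<Rightarrow> complex^6. p (\<lambda>_. v (Some i)))" if "p \<in> E i" for i p
    by (rule polynomial_fun_reindex[OF assms(1)[OF that]])
  show "polynomial_fun (\<lambda>v :: 'n option \<Rightarrow> complex^6. p (\<lambda>i. v (Some i)))" if "p \<in> P" for p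
    by (rule polynomial_fun_reindex[OF assms(2)[OF that]])
qed

text \<open>This is the invariance under which the block of a line may be projected away as a
  projective point.\<close>

lemma elimination_system_scale:
  fixes v :: "'n::finite option \<Rightarrow> complex^6"
  assumes E: "\<And>i p. p \<in> E i \<Longrightarrow> multihomogeneous p" and P: "\<And>p. p \<in> P \<Longrightarrow> multihomogeneous p"
    and v: "v \<in> elimination_system E P"
  shows "v(Some j := r *s v (Some j)) \<in> elimination_system E P"
proof -
  define c where "c i = (if i = j then r else 1)" for i
  have c: "(v(Some j := r *s v (Some j))) (Some i) = c i *s v (Some i)" for i
    by (simp add: c_def)
  have "p (\<lambda>_. c i *s v (Some i)) = 0" if "p \<in> E i" for p i
    using multihomogeneous_scale_zero[OF E[OF that], of "\<lambda>_. v (Some i)" "\<lambda>_. c i"] v that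
    by (simp add: elimination_system_def)
  moreover have "p (\<lambda>i. c i *s v (Some i)) = 0" if "p \<in> P" for p
    using multihomogeneous_scale_zero[OF P[OF that], of "\<lambda>i. v (Some i)" c] v that
    by (simp add: elimination_system_def)
  ultimately show ?thesis
    using v unfolding elimination_system_def mem_Collect_eq c
    by (simp add: quadric_scale incidence_scale)
qed

lemma ex_common_nonzero:
  assumes "finite I" "\<And>i. i \<in> I \<Longrightarrow> polynomial_fun (g i) \<and> (\<exists>v. g i v \<noteq> 0)"
  shows "\<exists>v. \<forall>i\<in>I. g i v \<noteq> 0"
  using assms
proof (induction I)
  case (insert i I)
  then obtain w where "\<forall>i\<in>I. g i w \<noteq> 0" by auto
  moreover obtain v where "g i v \<noteq> 0" using insert.prems by blast
  moreover have "polynomial_fun (g i)" "polynomial_fun (\<lambda>v. \<Prod>i\<in>I. g i v)"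
    using insert.prems by (auto intro: polynomial_fun_prod)
  ultimately obtain u where "g i u \<noteq> 0" "(\<Prod>i\<in>I. g i u) \<noteq> 0"
    using polynomial_fun_ex_nonzero_both[of "g i" "\<lambda>v. \<Prod>i\<in>I. g i v" v w] insert.hyps(1) by auto
  then show ?case using insert.hyps by auto
qed simp

text \<open>One polynomial for each congruence describes its general points; their finite product
  handles all congruences together.\<close>

lemma general_point_single_lines:
  fixes C :: "'n::finite \<Rightarrow> (complex^4) set set"
  assumes "\<And>i. has_order (C i) 1"
  shows "\<exists>g :: (unit \<Rightarrow> complex^4) \<Rightarrow> complex. polynomial_fun g \<and> (\<exists>v. g v \<noteq> 0) \<and>
    (\<forall>v. g v \<noteq> 0 \<longrightarrow> v () \<noteq> 0 \<and> (\<forall>i. \<exists>L. lines_through (C i) (vec.span {v ()}) = {L}))"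
proof -
  have "\<exists>g :: (unit \<Rightarrow> complex^4) \<Rightarrow> complex. polynomial_fun g \<and> (\<exists>v. g v \<noteq> 0) \<and>
    (\<forall>v. g v \<noteq> 0 \<longrightarrow> v () \<noteq> 0 \<and> (\<exists>L. lines_through (C i) (vec.span {v ()}) = {L}))" for i
  proof -
    obtain U where U: "openin projective_topology U" "U \<noteq> {}"
      "\<And>x. x \<in> U \<Longrightarrow> card (lines_through (C i) x) = 1"
      using assms[of i] unfolding has_order_def for_general_point_def by blast
    show ?thesis
      using nonempty_open_contains_polynomial_nonzeros[OF U(1,2)] U(3)
      by (metis card_1_singletonE)
  qed
  then obtain g :: "'n \<Rightarrow> (unit \<Rightarrow> complex^4) \<Rightarrow> complex" where
    g: "\<And>i. polynomial_fun (g i)" "\<And>i. \<exists>v. g i v \<noteq> 0"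
    "\<And>i v. g i v \<noteq> 0 \<Longrightarrow> v () \<noteq> 0 \<and> (\<exists>L. lines_through (C i) (vec.span {v ()}) = {L})"
    by metis
  obtain v where "\<forall>i\<in>UNIV. g i v \<noteq> 0"
    using ex_common_nonzero[of UNIV g] g(1,2) by auto
  then have "(\<Prod>i\<in>UNIV. g i v) \<noteq> 0" by simp
  moreover have "v () \<noteq> 0 \<and> (\<forall>i. \<exists>L. lines_through (C i) (vec.span {v ()}) = {L})"
    if "(\<Prod>i\<in>UNIV. g i v) \<noteq> 0" for v
    using that g(3) by auto
  ultimately show ?thesis
    using polynomial_fun_prod[of UNIV g] g(1) by (intro exI[of _ "\<lambda>v. \<Prod>i\<in>UNIV. g i v"]) blast
qed

text \<open>The incidence variety of pairs \<open>(x, M)\<close> with \<open>x \<subseteq> M \<in> C j\<close> is parametrised by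
  \<open>x = contraction p a\<close>, hence irreducible; over general \<open>x\<close> the pair lies in the algebraic set
  obtained by eliminating the lines other than \<open>M\<close>.\<close>

lemma point_line_config_in_elimination:
  fixes C :: "'n::finite \<Rightarrow> (complex^4) set set"
  assumes irr: "irreducible_in Gr_topology (C j)" and order: "\<And>i. has_order (C i) 1"
    and CGr: "\<And>i. C i \<subseteq> Gr"
    and T: "algebraic_set T"
    and general: "\<And>x p K q. x \<noteq> 0 \<Longrightarrow> (\<And>i. lines_through (C i) (vec.span {x}) = {K i}) \<Longrightarrow>
      (\<And>i. q i \<in> pluecker (K i)) \<Longrightarrow> (\<And>i. q i \<noteq> 0) \<Longrightarrow> point_line_config j x (q j) \<in> T"
    and M: "M \<in> C j" "p \<in> pluecker M" "p \<noteq> 0" "x \<in> M"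
  shows "point_line_config j x p \<in> T"
proof (rule ccontr)
  assume "point_line_config j x p \<notin> T"
  then obtain m where m: "polynomial_fun m" "m (point_line_config j x p) \<noteq> 0" "\<And>w. w \<in> T \<Longrightarrow> m w = 0"
    using algebraic_setE[OF T] by blast
  obtain g :: "(unit \<Rightarrow> complex^4) \<Rightarrow> complex" and v1 where g: "polynomial_fun g" "g v1 \<noteq> 0"
    "\<And>v. g v \<noteq> 0 \<Longrightarrow> v () \<noteq> 0"
    "\<And>v. g v \<noteq> 0 \<Longrightarrow> \<forall>i. \<exists>L. lines_through (C i) (vec.span {v ()}) = {L}"
    using general_point_single_lines[of C] order by blast
  have poly_m: "polynomial_fun (\<lambda>v. m (point_line_config j (\<phi> v) (\<psi> v)))"
    if "\<And>k. polynomial_fun (\<lambda>v. \<phi> v $ k)" "\<And>k. polynomial_fun (\<lambda>v. \<psi> v $ k)" for \<phi> \<psi>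
  proof (rule polynomial_fun_compose[OF m(1)])
    show "polynomial_fun (\<lambda>v. point_line_config j (\<phi> v) (\<psi> v) i $ k)" for i k
    proof (cases i)
      case None
      then show ?thesis using polynomial_fun_point_block[OF that(1)] by (simp add: point_line_config_def)
    next
      case (Some i')
      then show ?thesis
        using that(2) by (cases "i' = j") (simp_all add: point_line_config_def polynomial_fun.const)
    qed
  qed
  have poly_g: "polynomial_fun (\<lambda>v. g (\<lambda>_. \<phi> v))" if "\<And>k. polynomial_fun (\<lambda>v. \<phi> v $ k)" for \<phi>
    using that by (intro polynomial_fun_compose[OF g(1)])
  obtain a where a: "x = contraction p a"
    using Gr_contraction[of M p] M CGr by blast
  obtain M1 where "lines_through (C j) (vec.span {v1 ()}) = {M1}"
    using g(2,4) by blast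
  then have M1: "M1 \<in> C j" "v1 () \<in> M1"
    unfolding lines_through_def using vec.span_base[of "v1 ()" "{v1 ()}"] by blast+
  obtain p1 where p1: "p1 \<noteq> 0" "p1 \<in> pluecker M1"
    using Gr_ex_pluecker[of M1] M1(1) CGr by blast
  obtain a1 where a1: "v1 () = contraction p1 a1"
    using Gr_contraction[of M1 p1] M1 p1 CGr by blast
  have "v1 = (\<lambda>_. contraction p1 a1)" using a1 by (auto simp: fun_eq_iff)
  then have "g (\<lambda>_. contraction p1 a1) \<noteq> 0" using g(2) by simp
  moreover have "polynomial_fun (\<lambda>v :: unit \<Rightarrow> complex^6. m (point_line_config j (contraction (v ()) a) (v ())))"
    by (intro poly_m polynomial_fun_contraction polynomial_fun.intros)
  moreover have "polynomial_fun (\<lambda>v :: unit \<Rightarrow> complex^6. g (\<lambda>_. contraction (v ()) a1))"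
    by (intro poly_g polynomial_fun_contraction polynomial_fun.intros)
  \<comment> \<open>Move the line while both covectors stay fixed: on a common line,
    \<open>m\<close> survives at the covector \<open>a\<close> and \<open>g\<close> at the covector
    \<open>a1\<close>.\<close>
  ultimately have "\<exists>M\<in>C j. \<exists>r. r \<in> pluecker M \<and> r \<noteq> 0 \<and>
      m (point_line_config j (contraction r a) r) \<noteq> 0 \<and> g (\<lambda>_. contraction r a1) \<noteq> 0"
    using irreducible_ex_nonzero_both[OF irr, of
        "\<lambda>v. m (point_line_config j (contraction (v ()) a) (v ()))"
        "\<lambda>v. g (\<lambda>_. contraction (v ()) a1)" M p M1 p1]
      M(1-3) M1(1) p1 m(2) a by simp
  then obtain M2 p2 where M2: "M2 \<in> C j" "p2 \<in> pluecker M2" "p2 \<noteq> 0"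
    "m (point_line_config j (contraction p2 a) p2) \<noteq> 0" "g (\<lambda>_. contraction p2 a1) \<noteq> 0"
    by blast
  have "polynomial_fun (\<lambda>v :: unit \<Rightarrow> complex^4. m (point_line_config j (contraction p2 (v ())) p2))"
    by (intro poly_m polynomial_fun_contraction polynomial_fun.intros)
  moreover have "polynomial_fun (\<lambda>v :: unit \<Rightarrow> complex^4. g (\<lambda>_. contraction p2 (v ())))"
    by (intro poly_g polynomial_fun_contraction polynomial_fun.intros)
  \<comment> \<open>Now keep the line and move the covector, so that a single point of
    \<open>M2\<close> serves both polynomials.\<close>
  ultimately obtain u :: "unit \<Rightarrow> complex^4" where
    "m (point_line_config j (contraction p2 (u ())) p2) \<noteq> 0" "g (\<lambda>_. contraction p2 (u ())) \<noteq> 0"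
    using polynomial_fun_ex_nonzero_both[of
        "\<lambda>v :: unit \<Rightarrow> complex^4. m (point_line_config j (contraction p2 (v ())) p2)"
        "\<lambda>v :: unit \<Rightarrow> complex^4. g (\<lambda>_. contraction p2 (v ()))" "\<lambda>_. a" "\<lambda>_. a1"] M2(4,5)
    by auto
  then obtain x2 where x2: "x2 = contraction p2 (u ())"
    "m (point_line_config j x2 p2) \<noteq> 0" "g (\<lambda>_. x2) \<noteq> 0" by blast
  have nz: "x2 \<noteq> 0" using g(3)[OF x2(3)] .
  obtain K where K: "\<And>i. lines_through (C i) (vec.span {x2}) = {K i}"
    using g(4)[OF x2(3)] by metis
  have "K i \<in> C i" for i using K[of i] unfolding lines_through_def by blast
  then have KGr: "K i \<in> Gr" for i using CGr by blast
  have "x2 \<in> M2" using Gr_contraction[of M2 p2] M2 CGr x2(1) by blast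
  then have "vec.span {x2} \<subseteq> M2"
    using M2(1) CGr by (intro vec.span_minimal) (auto simp: Gr_def)
  \<comment> \<open>The point \<open>x2\<close> is general and lies on \<open>M2\<close>, which
    therefore is its only line in \<open>C j\<close>.\<close>
  then have Kj: "K j = M2" using K[of j] M2(1) unfolding lines_through_def by blast
  obtain q where q: "\<And>i. q i \<in> pluecker (K i) \<and> q i \<noteq> 0"
    using multi_projective_space_ex_nonzero[OF Gr_pluecker_multi_projective] KGr by blast
  \<comment> \<open>\<open>m\<close> is known to be nonzero at the particular vector
    \<open>p2\<close>, so \<open>p2\<close> has to represent the \<open>j\<close>-th line.\<close>
  have "point_line_config j x2 ((q(j := p2)) j) \<in> T"
    using general[OF nz K, of "q(j := p2)"] q M2(2,3) Kj by simp
  then show False using m(3) x2(2) by simp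
qed

theorem theorem5p1:
  fixes C :: "'n::finite \<Rightarrow> (complex^4) set set" and \<beta> :: "'n \<Rightarrow> nat"
  assumes "\<And>i. congruence (C i)"
    and "\<And>i. has_bidegree (C i) (1, \<beta> i)"
    and "\<And>i j. i \<noteq> j \<Longrightarrow> focal_locus (C i) \<inter> focal_locus (C j) = {}"
  shows "multi_image_variety C = concurrent_lines_variety \<inter> (\<Pi> i\<in>UNIV. C i)"
proof -
  have closed: "closedin Gr_topology (C i)" and irr: "irreducible_in Gr_topology (C i)" for i
    using assms(1)[of i] by (simp_all add: congruence_def)
  have order: "has_order (C i) 1" for i
    using assms(2)[of i] by (simp add: has_bidegree_def)
  have CGr: "C i \<subseteq> Gr" for i
    using irr[of i] by (simp add: irreducible_in_def topspace_Gr_topology)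
  define I where "I = (\<lambda>x i. rational_camera (C i) x) ` (projective_space - (\<Union>i. focal_locus (C i)))"
  have M: "multi_image_variety C = Gr_power_topology closure_of I"
    by (simp add: multi_image_variety_def I_def)
  have I: "I \<subseteq> concurrent_lines_variety \<inter> (\<Pi> i\<in>UNIV. C i)"
  proof
    fix L assume "L \<in> I"
    then obtain x where x: "x \<in> projective_space" "\<And>i. x \<notin> focal_locus (C i)"
      "L = (\<lambda>i. rational_camera (C i) x)"
      unfolding I_def by blast
    have "L i \<in> lines_through (C i) x" for i
      using not_focal_iff[OF order x(1)] x(2)[of i] rational_camera_eq x(3) by fastforce
    then have "L i \<in> C i" "x \<subseteq> L i" for i by (auto simp: lines_through_def)
    then show "L \<in> concurrent_lines_variety \<inter> (\<Pi> i\<in>UNIV. C i)"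
      unfolding concurrent_lines_variety_def using x(1) CGr by blast
  qed
  have "closedin Gr_power_topology (concurrent_lines_variety \<inter> (\<Pi> i\<in>UNIV. C i))"
    using closed by (intro closedin_Int closedin_concurrent_lines_variety closedin_Gr_power_Pi)
  then have "multi_image_variety C \<subseteq> concurrent_lines_variety \<inter> (\<Pi> i\<in>UNIV. C i)"
    unfolding M using I by (intro closure_of_minimal)
  moreover have "L \<in> multi_image_variety C"
    if L: "L \<in> concurrent_lines_variety" "L \<in> (\<Pi> i\<in>UNIV. C i)" for L
  proof -
    have LC: "L i \<in> C i" for i using L(2) by auto
    then have LGr: "L i \<in> Gr" for i using CGr by blast
    obtain x where x: "x \<in> projective_space" "\<And>i. x \<subseteq> L i"
      using L(1) by (auto simp: concurrent_lines_variety_def)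
    obtain x0 where x0: "x0 \<in> x" "x0 \<noteq> 0" using projective_space_ex_nonzero[OF x(1)] by blast
    have x0L: "x0 \<in> L i" for i using x0(1) x(2)[of i] by blast
    \<comment> \<open>The point lies in at most one focal locus; \<open>j\<close> is its index, or
      any index if there is none.\<close>
    obtain j where j: "\<And>i. i \<noteq> j \<Longrightarrow> x \<notin> focal_locus (C i)"
      using assms(3) by blast
    have "I \<subseteq> topspace Gr_power_topology"
      using I CGr by (fastforce simp: topspace_Gr_power_topology)
    then have IM: "I \<subseteq> multi_image_variety C"
      unfolding M by (rule closure_of_subset)
    have "closedin Gr_power_topology (multi_image_variety C)"
      unfolding M by (rule closedin_closure_of)
    from this[unfolded closedin_Gr_power_topology] obtain P where
      "(\<forall>p\<in>P. polynomial_fun p \<and> multihomogeneous p) \<and>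
       multi_image_variety C = {L\<in>(\<Pi> i\<in>UNIV. Gr). \<forall>p\<in>P. vanishes_at p (\<lambda>i. pluecker (L i))}" ..
    then have P: "\<And>p. p \<in> P \<Longrightarrow> polynomial_fun p" "\<And>p. p \<in> P \<Longrightarrow> multihomogeneous p"
      "multi_image_variety C = {L\<in>(\<Pi> i\<in>UNIV. Gr). \<forall>p\<in>P. vanishes_at p (\<lambda>i. pluecker (L i))}"
      by simp_all
    have "\<forall>i. \<exists>E. (\<forall>p\<in>E. polynomial_fun p \<and> multihomogeneous p) \<and>
        C i = {L\<in>Gr. \<forall>p\<in>E. vanishes_at p (\<lambda>_::unit. pluecker L)}"
      using closed by (simp add: closedin_Gr_topology)
    from choice[OF this] obtain E where "\<forall>i. (\<forall>p\<in>E i. polynomial_fun p \<and> multihomogeneous p) \<and>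
        C i = {L\<in>Gr. \<forall>p\<in>E i. vanishes_at p (\<lambda>_::unit. pluecker L)}" ..
    then have E: "\<And>i p. p \<in> E i \<Longrightarrow> polynomial_fun p" "\<And>i p. p \<in> E i \<Longrightarrow> multihomogeneous p"
      "\<And>i. C i = {L\<in>Gr. \<forall>p\<in>E i. vanishes_at p (\<lambda>_::unit. pluecker L)}"
      by simp_all
    have C_iff: "K \<in> C i \<longleftrightarrow> (\<forall>p\<in>E i. p (\<lambda>_. q) = 0)"
      if "K \<in> Gr" "q \<in> pluecker K" "q \<noteq> 0" for K q i
      unfolding E(3)[of i]
      using that vanishes_at_iff[OF Gr_pluecker_multi_projective E(2), of "\<lambda>_. K" _ i "\<lambda>_. q"] by auto
    have M_iff: "K \<in> multi_image_variety C \<longleftrightarrow> (\<forall>p\<in>P. p q = 0)"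
      if "\<And>i. K i \<in> Gr" "\<And>i. q i \<in> pluecker (K i)" "\<And>i. q i \<noteq> 0" for K q
      unfolding P(3)
      using that vanishes_at_iff[OF Gr_pluecker_multi_projective P(2), of K _ q] by auto
    define S where "S = elimination_system E P"
    have S: "w \<in> S \<longleftrightarrow> (\<forall>i. block_point (w None) \<in> K i) \<and> (\<forall>i. K i \<in> C i) \<and> K \<in> multi_image_variety C"
      if "\<And>i. K i \<in> Gr" "\<And>i. w (Some i) \<in> pluecker (K i)" "\<And>i. w (Some i) \<noteq> 0" for w K
    proof -
      have "quadric (w (Some i)) = 0" for i
        using Gr_eq_incidence(1) that by blast
      moreover have "block_point (w None) \<in> K i \<longleftrightarrow> incidence (w (Some i)) (block_point (w None)) = 0" for i
        using Gr_eq_incidence(2)[OF that(1) that(2) that(3)] by blast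
      ultimately show ?thesis
        using C_iff[OF that(1) that(2) that(3)] M_iff[of K "\<lambda>i. w (Some i)"] that
        by (simp add: S_def elimination_system_def vec_eq_iff)
    qed
    \<comment> \<open>The blocks to be eliminated: all lines but the \<open>j\<close>-th. The point
      and the \<open>j\<close>-th line remain parameters.\<close>
    define J where "J = Some ` (UNIV - {j})"
    define T where "T = {v. \<exists>w\<in>S. (\<forall>i. i \<notin> J \<longrightarrow> w i = v i) \<and> (\<forall>i\<in>J. w i \<noteq> 0)}"
    have "algebraic_set T"
      unfolding T_def
    proof (rule algebraic_set_project_blocks)
      show "finite J" by (simp add: J_def)
      show "algebraic_set S"
        unfolding S_def using E(1) P(1) by (rule algebraic_set_elimination_system)
      show "v(i := r *s v i) \<in> S" if "i \<in> J" "v \<in> S" for v i r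
        using that elimination_system_scale[of E P v _ r] E(2) P(2) by (auto simp: S_def J_def)
    qed
    obtain p where p: "\<And>i. p i \<in> pluecker (L i) \<and> p i \<noteq> 0"
      using multi_projective_space_ex_nonzero[OF Gr_pluecker_multi_projective] LGr by blast
    have "point_line_config j x0 (p j) \<in> T"
    proof (rule point_line_config_in_elimination[where C = C and M = "L j"])
      fix x p K q
      assume *: "x \<noteq> 0" "\<And>i. lines_through (C i) (vec.span {x}) = {K i}"
        "\<And>i. q i \<in> pluecker (K i)" "\<And>i. q i \<noteq> 0"
      have KC: "K i \<in> C i" "vec.span {x} \<subseteq> K i" for i
        using *(2)[of i] unfolding lines_through_def by blast+
      have "vec.span {x} \<notin> focal_locus (C i)" for i
        using not_focal_iff[OF order span_in_projective_space[OF *(1)]] *(2) by blast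
      moreover have "K = (\<lambda>i. rational_camera (C i) (vec.span {x}))"
        using rational_camera_eq[OF *(2)] by simp
      ultimately have "K \<in> I"
        unfolding I_def using span_in_projective_space[OF *(1)] by blast
      \<comment> \<open>The camera values at a general point fill the eliminated blocks and lie in
        the multi-image variety.\<close>
      moreover define w where "w = (\<lambda>i. case i of None \<Rightarrow> point_block x | Some i \<Rightarrow> q i)"
      have "x \<in> K i" for i using KC(2)[of i] vec.span_base[of x "{x}"] by blast
      moreover have "K i \<in> Gr" for i using KC(1) CGr by blast
      ultimately have "w \<in> S"
        using S[of K w] KC(1) *(3,4) IM by (auto simp: w_def)
      moreover have "w i = point_line_config j x (q j) i" if "i \<notin> J" for i
        using that by (auto simp: w_def point_line_config_def J_def split: option.split)
      moreover have "w i \<noteq> 0" if "i \<in> J" for i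
        using that *(4) by (auto simp: w_def J_def)
      ultimately show "point_line_config j x (q j) \<in> T"
        unfolding T_def by blast
    qed (use irr order CGr \<open>algebraic_set T\<close> LC p x0L in auto)
    then obtain w where w: "w \<in> S" "\<And>i. i \<notin> J \<Longrightarrow> w i = point_line_config j x0 (p j) i"
      "\<And>i. i \<in> J \<Longrightarrow> w i \<noteq> 0"
      unfolding T_def by blast
    have w_None: "w None = point_block x0" and w_j: "w (Some j) = p j"
      using w(2)[of None] w(2)[of "Some j"] by (auto simp: J_def point_line_config_def)
    \<comment> \<open>Elimination guarantees this for the eliminated blocks, and the block of
      \<open>j\<close> is the given Pluecker vector of \<open>L j\<close>.\<close>
    have nz: "w (Some i) \<noteq> 0" for i
      using w(3)[of "Some i"] w_j p by (cases "i = j") (auto simp: J_def)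
    have "\<exists>K\<in>Gr. w (Some i) \<in> pluecker K" for i
      using quadric_ex_Gr[OF nz] w(1) by (simp add: S_def elimination_system_def)
    then obtain K where K: "\<And>i. K i \<in> Gr" "\<And>i. w (Some i) \<in> pluecker (K i)" by metis
    have K': "\<And>i. x0 \<in> K i" "\<And>i. K i \<in> C i" "K \<in> multi_image_variety C"
      using S[of K w, OF K nz] w(1) w_None by auto
    \<comment> \<open>The \<open>j\<close>-th line agrees because its block was a parameter. For
      other indices both lines pass through \<open>x\<close>, which is not focal for
      \<open>C i\<close>.\<close>
    have "K i = L i" for i
    proof (cases "i = j")
      case True
      then show ?thesis
        using Gr_eq_incidence(2)[OF K(1)[of j] K(2) nz] Gr_eq_incidence(2)[OF LGr[of j], of "p j"] p w_j
        by simp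
    next
      case False
      obtain N where N: "lines_through (C i) x = {N}"
        using not_focal_iff[OF order x(1)] j[OF False] by blast
      have "vec.span {x0} \<subseteq> K i"
        using K(1)[of i] K'(1)[of i] by (intro vec.span_minimal) (auto simp: Gr_def)
      then have "x \<subseteq> K i"
        using projective_space_eq_span[OF x(1) x0] by simp
      then have "K i \<in> lines_through (C i) x" "L i \<in> lines_through (C i) x"
        using K'(2)[of i] LC[of i] x(2)[of i] by (simp_all add: lines_through_def)
      then show ?thesis unfolding N by simp
    qed
    then have "K = L" by auto
    then show "L \<in> multi_image_variety C" using K'(3) by simp
  qed
  ultimately show ?thesis by blast
qed

end
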